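(* Let $E$ be a real Banach space and $F$ a real Hilbert space with a Besselian Schauder basis $(b_i)_{i\in\mathbb N}$, and let $J_1\subset\mathbb N$. Let $U\subset E$ be open, $x_0\in U$, and let $(f_i)_{i\in J_1}:U\to Y(J_1)$ be a $C^1$ mapping. Assume that the Constant Rank Condition Plus (CRC+) holds for $(f_i)_{i\in J_1}$ at $x_0$ with a neighbourhood $V(x_0)$ and index set $J_2\subset J_1$. Then for every $x\in V(x_0)$ the map $$t_x:=\big((Df_i(x))_{i\in J_1}\big)\big|_{E_1}:E_1\to (Df_i(x))_{i\in J_1}(E)$$ is an isomorphism, where $E_1:=X_1^*=\overline{\operatorname{span}}(Df_i(x_0)^*,\ i\in J_2)$.
   Context: Schauder basis of a Banach space $X$: a sequence $(v_i)$ such that every $x\in X$ has a unique expansion $x=\sum_i a_iv_i$ (for finite-dimensional $X$, a linear basis); the biorthogonal functionals $v_i^*\in X^*$ satisfy $v_i^*(v_j)=\delta_{ij}$, $x=\sum_i v_i^*(x)v_i$. A basis $(c_i)$ is Besselian if convergence of $\sum_i\alpha_ic_i$ implies $\sum_i\alpha_i^2<\infty$. It is boundedly-complete if $\sup_N\|\sum_{i\le N}a_iv_i\|<\infty$ implies convergence of $\sum a_iv_i$, and shrinking if $(v_i^* )$ is a basis of $X^*$. $\overline{\operatorname{span}}$ is the norm-closed linear span. For $J=\{j_1<j_2<\dots\}\subset\mathbb N$: $Y(J)=\{(c_i)_{i\in J}\mid\sum_{i\in J}c_ib_i\text{ converges in }F\}$ with norm $\sup_N\|\sum_{k=1}^Nc_{j_k}b_{j_k}\|$.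 $(Df_i(x))_{i\in J}$ also denotes the linear map $e\mapsto(Df_i(x)e)_{i\in J}$, and $(Df_i(x))_{i\in J}(E)$ its image. CRC+ for $(f_i)_{i\in J_1}$ at $x_0$ with neighbourhood $V(x_0)$ and index set $J_2\subset J_1$ means: 1. $(Df_i(x))_{i\in J_2}$ is a Schauder basis of $\overline{\operatorname{span}}(Df_i(x),\,i\in J_1)\subset E^*$ for all $x\in V(x_0)$; 2. for every $x\in V(x_0)$ there is a (linear) topological isomorphism $z_x:\overline{\operatorname{span}}(Df_i(x),i\in J_2)\to\overline{\operatorname{span}}(Df_i(x_0),i\in J_2)$ with $z_x(Df_i(x))=Df_i(x_0)$, $i\in J_2$; 3. $(Df_i(x_0))_{i\in J_2}(E)$ is closed in $Y(J_2)$; 4. $(Df_i(x_0))_{i\in J_2}$ is a shrinking and boundedly-complete basis of $X_1:=\overline{\operatorname{span}}(Df_i(x_0),i\in J_1)$; 5. $(Df_i(x_0))_{i\in J_2}$ is Besselian for $X_1$; 6. $Df_i(x_0)^*\in E$ for $i\in J_2$, where $Df_i(x_0)^*\in X_1^*$ are the functionals biorthogonal to the basis $(Df_i(x_0))_{i\in J_2}$ of $X_1$. Convention on $Df_i(x_0)^*$: $E$ is regarded as a subspace of $E^{**}$ canonically, and $X_1^*$ is regarded as a subspace of $E^{**}$, i.e. a bounded linear map $\iota:X_1^*\to E^{**}$ with $\iota(\varphi)|_{X_1}=\varphi$ for all $\varphi\in X_1^*$ is fixed and $\varphi$ is identified with $\iota(\varphi)$. Condition 6 says that $\iota(Df_i(x_0)^*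 )$ is (evaluation at) an element of $E$, and $E_1$ is the closed span in $E$ of these elements.
   Formalization: The isomorphism is proved for all x in some smaller neighbourhood W of x_0 inside V(x_0), again satisfying CRC+, not for every x in V(x_0); the latter fails for f_0(s,t)=e^s cos t on R^2, J_1=J_2={0}, V(x_0)=R^2, x_0=0, at (0,π/2). *)

theory Defs
  imports "HOL-Analysis.Analysis" "HOL-Library.Function_Algebras"
begin

text \<open>
  The sequence spaces \<open>Y(J)\<close> and the duals of closed subspaces depend on parameters, so they are
  given as a carrier inside a real vector space together with a norm function on that carrier.
  Real-valued functions carry the pointwise vector space structure.
\<close>

instantiation "fun" :: (type, real_vector) real_vector
begin

definition scaleR_fun :: "real \<Rightarrow> ('a \<Rightarrow> 'b) \<Rightarrow> 'a \<Rightarrow> 'b"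
  where "scaleR_fun r f = (\<lambda>x. r *\<^sub>R f x)"

instance
  by standard (simp_all add: scaleR_fun_def fun_eq_iff scaleR_add_right scaleR_add_left)

end

definition bounded_linear_between ::
  "'a::real_vector set \<Rightarrow> ('a \<Rightarrow> real) \<Rightarrow> 'b::real_vector set \<Rightarrow> ('b \<Rightarrow> real) \<Rightarrow> ('a \<Rightarrow> 'b) \<Rightarrow> bool"
  where "bounded_linear_between A nA B nB T \<longleftrightarrow>
    T ` A \<subseteq> B \<and>
    (\<forall>x\<in>A. \<forall>y\<in>A. T (x + y) = T x + T y) \<and>
    (\<forall>r. \<forall>x\<in>A. T (r *\<^sub>R x) = r *\<^sub>R T x) \<and>
    (\<exists>K. \<forall>x\<in>A. nB (T x) \<le> K * nA x)"

definition topological_isomorphism ::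
  "'a::real_vector set \<Rightarrow> ('a \<Rightarrow> real) \<Rightarrow> 'b::real_vector set \<Rightarrow> ('b \<Rightarrow> real) \<Rightarrow> ('a \<Rightarrow> 'b) \<Rightarrow> bool"
  where "topological_isomorphism A nA B nB T \<longleftrightarrow>
    bij_betw T A B \<and> bounded_linear_between A nA B nB T \<and>
    bounded_linear_between B nB A nA (inv_into A T)"

definition norm_closed_in :: "'a::real_vector set \<Rightarrow> ('a \<Rightarrow> real) \<Rightarrow> 'a set \<Rightarrow> bool"
  where "norm_closed_in Y nY S \<longleftrightarrow>
    S \<subseteq> Y \<and> (\<forall>s. \<forall>y\<in>Y. (\<forall>n::nat. s n \<in> S) \<and> (\<lambda>n. nY (s n - y)) \<longlonglongrightarrow> 0 \<longrightarrow> y \<in> S)"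

definition C1_mapping_on ::
  "'e::real_normed_vector set \<Rightarrow> 'a::real_vector set \<Rightarrow> ('a \<Rightarrow> real) \<Rightarrow> ('e \<Rightarrow> 'a) \<Rightarrow> bool"
  where "C1_mapping_on U Y nY f \<longleftrightarrow>
    f ` U \<subseteq> Y \<and>
    (\<exists>f'. (\<forall>x\<in>U. bounded_linear_between UNIV norm Y nY (f' x) \<and>
                  ((\<lambda>h. nY (f (x + h) - f x - f' x h) / norm h) \<longlongrightarrow> 0) (at 0)) \<and>
          (\<forall>x\<in>U. \<forall>\<epsilon>>0. \<exists>\<delta>>0. \<forall>y\<in>U. dist y x < \<delta> \<longrightarrow>
             (\<forall>e. nY (f' y e - f' x e) \<le> \<epsilon> * norm e)))"


section \<open>Schauder bases\<close>

text \<open>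
  Families indexed by \<open>J \<subseteq> \<nat>\<close> are taken in the increasing order of \<open>J\<close>.  Coefficient
  families are extended by \<open>0\<close> outside \<open>J\<close>, so that the partial sums along \<open>J\<close> are the sums
  over \<open>i < N\<close>; values \<open>v i\<close> with \<open>i \<notin> J\<close> are irrelevant.  For finite \<open>J\<close> the partial sums
  are eventually constant and a Schauder basis is a linear basis.
\<close>

definition coeffs_on :: "nat set \<Rightarrow> (nat \<Rightarrow> real) set"
  where "coeffs_on J = {a. \<forall>i. i \<notin> J \<longrightarrow> a i = 0}"

definition expansion :: "('a::real_vector \<Rightarrow> real) \<Rightarrow> (nat \<Rightarrow> 'a) \<Rightarrow> (nat \<Rightarrow> real) \<Rightarrow> 'a \<Rightarrow> bool"
  where "expansion nX v a x \<longleftrightarrow> (\<lambda>N. nX (x - (\<Sum>i<N. a i *\<^sub>R v i))) \<longlonglongrightarrow> 0"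

definition schauder_basis ::
  "'a::real_vector set \<Rightarrow> ('a \<Rightarrow> real) \<Rightarrow> nat set \<Rightarrow> (nat \<Rightarrow> 'a) \<Rightarrow> bool"
  where "schauder_basis X nX J v \<longleftrightarrow>
    (\<forall>i\<in>J. v i \<in> X) \<and> (\<forall>x\<in>X. \<exists>!a. a \<in> coeffs_on J \<and> expansion nX v a x)"

definition biorthogonal ::
  "'a::real_vector set \<Rightarrow> ('a \<Rightarrow> real) \<Rightarrow> nat set \<Rightarrow> (nat \<Rightarrow> 'a) \<Rightarrow> nat \<Rightarrow> 'a \<Rightarrow> real"
  where "biorthogonal X nX J v i =
    (\<lambda>x. if x \<in> X then (THE a. a \<in> coeffs_on J \<and> expansion nX v a x) i else 0)"

text \<open>Elements of the dual of \<open>X\<close> are extended by \<open>0\<close> outside the carrier \<open>X\<close>.\<close>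

definition dual :: "'a::real_vector set \<Rightarrow> ('a \<Rightarrow> real) \<Rightarrow> ('a \<Rightarrow> real) set"
  where "dual X nX = {\<phi>. bounded_linear_between X nX UNIV norm \<phi> \<and> (\<forall>x. x \<notin> X \<longrightarrow> \<phi> x = 0)}"

definition dual_norm :: "'a::real_vector set \<Rightarrow> ('a \<Rightarrow> real) \<Rightarrow> ('a \<Rightarrow> real) \<Rightarrow> real"
  where "dual_norm X nX \<phi> = (SUP x\<in>{x \<in> X. nX x \<le> 1}. \<bar>\<phi> x\<bar>)"

definition besselian ::
  "'a::real_vector set \<Rightarrow> ('a \<Rightarrow> real) \<Rightarrow> nat set \<Rightarrow> (nat \<Rightarrow> 'a) \<Rightarrow> bool"
  where "besselian X nX J v \<longleftrightarrow>
    (\<forall>a\<in>coeffs_on J. (\<exists>x\<in>X. expansion nX v a x) \<longrightarrow> summable (\<lambda>i. (a i)\<^sup>2))"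

definition boundedly_complete ::
  "'a::real_vector set \<Rightarrow> ('a \<Rightarrow> real) \<Rightarrow> nat set \<Rightarrow> (nat \<Rightarrow> 'a) \<Rightarrow> bool"
  where "boundedly_complete X nX J v \<longleftrightarrow>
    (\<forall>a\<in>coeffs_on J. (\<exists>K. \<forall>N. nX (\<Sum>i<N. a i *\<^sub>R v i) \<le> K) \<longrightarrow> (\<exists>x\<in>X. expansion nX v a x))"

definition shrinking ::
  "'a::real_vector set \<Rightarrow> ('a \<Rightarrow> real) \<Rightarrow> nat set \<Rightarrow> (nat \<Rightarrow> 'a) \<Rightarrow> bool"
  where "shrinking X nX J v \<longleftrightarrow>
    schauder_basis (dual X nX) (dual_norm X nX) J (biorthogonal X nX J v)"


section \<open>The spaces \<open>Y(J)\<close> and the condition CRC+\<close>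

definition Y_space :: "(nat \<Rightarrow> 'f::real_normed_vector) \<Rightarrow> nat set \<Rightarrow> (nat \<Rightarrow> real) set"
  where "Y_space b J = {c \<in> coeffs_on J. summable (\<lambda>i. c i *\<^sub>R b i)}"

text \<open>Independent of \<open>J\<close>, as members of \<open>Y(J)\<close> vanish outside \<open>J\<close>.\<close>

definition Y_norm :: "(nat \<Rightarrow> 'f::real_normed_vector) \<Rightarrow> (nat \<Rightarrow> real) \<Rightarrow> real"
  where "Y_norm b c = (SUP N. norm (\<Sum>i<N. c i *\<^sub>R b i))"

definition D :: "('e::real_normed_vector \<Rightarrow> nat \<Rightarrow> real) \<Rightarrow> 'e \<Rightarrow> nat \<Rightarrow> ('e \<Rightarrow>\<^sub>L real)"
  where "D f x i = Blinfun (frechet_derivative (\<lambda>y. f y i) (at x))"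

definition D_map ::
  "('e::real_normed_vector \<Rightarrow> nat \<Rightarrow> real) \<Rightarrow> 'e \<Rightarrow> nat set \<Rightarrow> 'e \<Rightarrow> nat \<Rightarrow> real"
  where "D_map f x J e = (\<lambda>i. if i \<in> J then blinfun_apply (D f x i) e else 0)"

definition D_span ::
  "('e::real_normed_vector \<Rightarrow> nat \<Rightarrow> real) \<Rightarrow> 'e \<Rightarrow> nat set \<Rightarrow> ('e \<Rightarrow>\<^sub>L real) set"
  where "D_span f x J = closure (span (D f x ` J))"

definition canonical :: "'e::real_normed_vector \<Rightarrow> (('e \<Rightarrow>\<^sub>L real) \<Rightarrow>\<^sub>L real)"
  where "canonical e = Blinfun (\<lambda>g. blinfun_apply g e)"

definition bidual_identification ::
  "('e::real_normed_vector \<Rightarrow>\<^sub>L real) set \<Rightarrow>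
   ((('e \<Rightarrow>\<^sub>L real) \<Rightarrow> real) \<Rightarrow> (('e \<Rightarrow>\<^sub>L real) \<Rightarrow>\<^sub>L real)) \<Rightarrow> bool"
  where "bidual_identification X \<iota> \<longleftrightarrow>
    bounded_linear_between (dual X norm) (dual_norm X norm) UNIV norm \<iota> \<and>
    (\<forall>\<phi>\<in>dual X norm. \<forall>g\<in>X. blinfun_apply (\<iota> \<phi>) g = \<phi> g)"

definition D_dual ::
  "('e::real_normed_vector \<Rightarrow> nat \<Rightarrow> real) \<Rightarrow> 'e \<Rightarrow> nat set \<Rightarrow> nat set \<Rightarrow> nat \<Rightarrow> ('e \<Rightarrow>\<^sub>L real) \<Rightarrow> real"
  where "D_dual f x0 J1 J2 = biorthogonal (D_span f x0 J1) norm J2 (D f x0)"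

definition E1_space ::
  "('e::real_normed_vector \<Rightarrow> nat \<Rightarrow> real) \<Rightarrow> 'e \<Rightarrow> nat set \<Rightarrow> nat set \<Rightarrow>
   ((('e \<Rightarrow>\<^sub>L real) \<Rightarrow> real) \<Rightarrow> (('e \<Rightarrow>\<^sub>L real) \<Rightarrow>\<^sub>L real)) \<Rightarrow> 'e set"
  where "E1_space f x0 J1 J2 \<iota> =
    closure (span {e. \<exists>i\<in>J2. canonical e = \<iota> (D_dual f x0 J1 J2 i)})"

definition CRC_plus ::
  "(nat \<Rightarrow> 'f::real_normed_vector) \<Rightarrow> ('e::real_normed_vector \<Rightarrow> nat \<Rightarrow> real) \<Rightarrow> 'e \<Rightarrow> 'e set \<Rightarrow>
   nat set \<Rightarrow> nat set \<Rightarrow> ((('e \<Rightarrow>\<^sub>L real) \<Rightarrow> real) \<Rightarrow> (('e \<Rightarrow>\<^sub>L real) \<Rightarrow>\<^sub>L real)) \<Rightarrow> bool"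
  where "CRC_plus b f x0 V J1 J2 \<iota> \<longleftrightarrow>
    x0 \<in> interior V \<and> J2 \<subseteq> J1 \<and>
    (\<forall>x\<in>V. schauder_basis (D_span f x J1) norm J2 (D f x)) \<and>
    (\<forall>x\<in>V. \<exists>z. topological_isomorphism (D_span f x J2) norm (D_span f x0 J2) norm z \<and>
                (\<forall>i\<in>J2. z (D f x i) = D f x0 i)) \<and>
    norm_closed_in (Y_space b J2) (Y_norm b) (range (D_map f x0 J2)) \<and>
    schauder_basis (D_span f x0 J1) norm J2 (D f x0) \<and>
    shrinking (D_span f x0 J1) norm J2 (D f x0) \<and>
    boundedly_complete (D_span f x0 J1) norm J2 (D f x0) \<and>
    besselian (D_span f x0 J1) norm J2 (D f x0) \<and>
    (\<forall>i\<in>J2. \<iota> (D_dual f x0 J1 J2 i) \<in> range canonical)"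

end

theory Submission
  imports Defs
begin

text \<open>
  The statement is a perturbation result, and the Besselian hypotheses provide its constants.  By the
  uniform boundedness principle (\<open>uniform_boundedness_on\<close>) they become estimates: the
  coefficients of \<open>w \<in> X\<^sub>1\<close> have \<open>\<ell>\<^sup>2\<close>-norm at most a constant times \<open>norm w\<close>, and the
  \<open>\<ell>\<^sup>2\<close>-norm of a member of \<open>Y(J\<^sub>1)\<close> is at most a constant times its \<open>Y\<close>-norm.

  At the base point, \<open>E\<^sub>1\<close> is a copy of the dual of \<open>X\<^sub>1\<close> (\<open>canonical_predual\<close>).  Two continuous linear
  maps agree on its generators, so every \<open>e \<in> E\<^sub>1\<close> is the element identified with its own restriction
  to \<open>X\<^sub>1\<close>; conversely, every functional on \<open>X\<^sub>1\<close> is a norm limit of combinations of the biorthogonal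
  functionals, because the basis is shrinking, and the canonical embedding is an isometry by the
  Hahn--Banach theorem (\<open>norming_functional\<close>), so the limit stays in \<open>E\<^sub>1\<close>.  By the first estimate, a
  square summable family \<open>c\<close> defines a bounded functional \<open>w \<mapsto> (\<Sum>i. \<alpha>\<^sub>i(w) c\<^sub>i)\<close> on \<open>X\<^sub>1\<close>.  Hence there
  is one and only one \<open>e \<in> E\<^sub>1\<close> with \<open>Df\<^sub>i(x\<^sub>0) e = c\<^sub>i\<close> for \<open>i \<in> J\<^sub>2\<close>, and \<open>norm e\<close> is at most a constant
  times the \<open>\<ell>\<^sup>2\<close>-norm of \<open>c\<close> (\<open>predual_interpolation\<close>, \<open>predual_estimate\<close>), so by the second estimate
  at most a constant \<open>M\<close> times the \<open>Y\<close>-norm, if \<open>c\<close> is the restriction to \<open>J\<^sub>2\<close> of a member of \<open>Y(J\<^sub>1)\<close>.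

  Now let \<open>x\<close> be so close to \<open>x\<^sub>0\<close> that the derivatives there differ by at most \<open>1 / (2 * M)\<close> in
  operator norm.  For \<open>h \<in> E\<close> let \<open>Q h\<close> be the element of \<open>E\<^sub>1\<close> with \<open>Df\<^sub>i(x\<^sub>0) (Q h) = Df\<^sub>i(x) h\<close> for
  \<open>i \<in> J\<^sub>2\<close>.  On \<open>E\<^sub>1\<close> it differs from the identity by an operator of norm at most \<open>1/2\<close>.  So the derivative
  at \<open>x\<close> is bounded below on \<open>E\<^sub>1\<close>, and Banach's fixed point theorem gives for every \<open>e \<in> E\<close> some
  \<open>a \<in> E\<^sub>1\<close> with \<open>Q (e - a) = 0\<close> (\<open>perturbed_isomorphism\<close>).  Then \<open>Df\<^sub>i(x) a = Df\<^sub>i(x) e\<close> for \<open>i \<in> J\<^sub>2\<close>,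
  and for all \<open>i \<in> J\<^sub>1\<close> since the functionals with index in \<open>J\<^sub>2\<close> span all of them
  (\<open>D_map_determined\<close>).  The neighbourhood \<open>W\<close> consists of the points of \<open>V\<close> that are close to \<open>x\<^sub>0\<close> in
  this sense.
\<close>


section \<open>Norming functionals\<close>

definition sublinear :: "('a::real_vector \<Rightarrow> real) \<Rightarrow> bool"
  where "sublinear p \<longleftrightarrow>
    (\<forall>x y. p (x + y) \<le> p x + p y) \<and> (\<forall>r>0. \<forall>x. p (r *\<^sub>R x) \<le> r * p x)"

lemma sublinear_add: "sublinear p \<Longrightarrow> p (x + y) \<le> p x + p y"
  by (simp add: sublinear_def)

lemma sublinear_scale:
  assumes "sublinear p" "r \<ge> 0"
  shows "p (r *\<^sub>R x) = r * p x"
proof (cases "r = 0")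
  case True
  have "p (2 *\<^sub>R 0) \<le> 2 * p 0" "p ((1/2) *\<^sub>R 0) \<le> (1/2) * p 0"
    using assms(1) unfolding sublinear_def by (metis zero_less_numeral, metis half_gt_zero zero_less_one)
  then show ?thesis using True by simp
next
  case False
  then have "r > 0" using assms by simp
  then have "p (r *\<^sub>R x) \<le> r * p x" "p (inverse r *\<^sub>R (r *\<^sub>R x)) \<le> inverse r * p (r *\<^sub>R x)"
    using assms(1) unfolding sublinear_def by (blast, meson inverse_positive_iff_positive)
  then show ?thesis using \<open>r > 0\<close> by (simp add: field_simps)
qed

lemma sublinear_zero: "sublinear p \<Longrightarrow> p 0 = 0"
  using sublinear_scale[of p 0 0] by simp

lemma sublinear_lower: "sublinear p \<Longrightarrow> - p (- x) \<le> p x"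
  using sublinear_add[of p x "- x"] sublinear_zero[of p] by simp

text \<open>
  The modification is linear along the line spanned by \<open>y\<close>, since \<open>q y \<le> p y\<close> and
  \<open>q (- y) \<le> - p y\<close> force equality in both.  It serves twice: applied to the norm, it fixes the
  value that a norming functional has to take, and applied to a minimal sublinear functional, it
  shows that this functional is linear.
\<close>

lemma sublinear_modification:
  fixes p :: "'a::real_vector \<Rightarrow> real"
  assumes p: "sublinear p"
  obtains q where "sublinear q" "\<And>x. q x \<le> p x" "q (- y) \<le> - p y"
proof
  define u where "u x t = p (x + t *\<^sub>R y) - t * p y" for x t
  define q where "q x = (INF t\<in>{0..}. u x t)" for x
  have low: "- p (- x) \<le> u x t" if "t \<ge> 0" for x t
    using sublinear_add[OF p, of "x + t *\<^sub>R y" "- x"] sublinear_scale[OF p that, of y]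
    by (simp add: u_def)
  have bdd: "bdd_below (u x ` {0..})" for x
    using low by (intro bdd_belowI2[where m = "- p (- x)"]) auto
  have q_le: "q x \<le> u x t" if "t \<ge> 0" for x t
    unfolding q_def using that by (intro cINF_lower bdd) auto
  have le_q: "c \<le> q x" if "\<And>t. t \<ge> 0 \<Longrightarrow> c \<le> u x t" for c x
    unfolding q_def using that by (intro cINF_greatest) auto
  show "sublinear q"
    unfolding sublinear_def
  proof (intro conjI allI impI)
    fix x x'
    have "q (x + x') \<le> u x t + u x' s" if "t \<ge> 0" "s \<ge> 0" for t s
    proof -
      have "q (x + x') \<le> u (x + x') (t + s)" using that by (intro q_le) auto
      also have "\<dots> \<le> u x t + u x' s"
        using sublinear_add[OF p, of "x + t *\<^sub>R y" "x' + s *\<^sub>R y"]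
        by (simp add: u_def algebra_simps)
      finally show ?thesis .
    qed
    then have "q (x + x') - u x' s \<le> q x" if "s \<ge> 0" for s
      using that by (intro le_q) (simp add: algebra_simps)
    then have "q (x + x') - q x \<le> q x'"
      by (intro le_q) (simp add: algebra_simps)
    then show "q (x + x') \<le> q x + q x'" by simp
  next
    fix r :: real and x assume r: "r > 0"
    have "q (r *\<^sub>R x) / r \<le> u x t" if "t \<ge> 0" for t
    proof -
      have "q (r *\<^sub>R x) \<le> u (r *\<^sub>R x) (r * t)" using r that by (intro q_le) auto
      also have "\<dots> = r * u x t"
        using sublinear_scale[OF p, of r "x + t *\<^sub>R y"] r by (simp add: u_def algebra_simps)
      finally show ?thesis using r by (simp add: field_simps)
    qed
    then have "q (r *\<^sub>R x) / r \<le> q x" by (rule le_q)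
    then show "q (r *\<^sub>R x) \<le> r * q x" using r by (simp add: field_simps)
  qed
  show "q x \<le> p x" for x using q_le[of 0 x] by (simp add: u_def)
  show "q (- y) \<le> - p y" using q_le[of 1 "- y"] sublinear_zero[OF p] by (simp add: u_def)
qed

text \<open>
  A minimal sublinear functional equals its modification in every direction and hence is odd; a
  subadditive odd functional is additive.
\<close>

lemma minimal_sublinear_linear:
  fixes p :: "'a::real_vector \<Rightarrow> real"
  assumes p: "sublinear p" and min: "\<And>q. sublinear q \<Longrightarrow> (\<And>x. q x \<le> p x) \<Longrightarrow> q = p"
  shows "linear p"
proof -
  have neg: "p (- y) = - p y" for y
  proof -
    obtain q where q: "sublinear q" "\<And>x. q x \<le> p x" "q (- y) \<le> - p y"
      using sublinear_modification[OF p] by blast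
    then have "p (- y) \<le> - p y" using min[of q] by simp
    moreover have "- p y \<le> p (- y)" using sublinear_lower[OF p, of y] by simp
    ultimately show ?thesis by simp
  qed
  show ?thesis
  proof (rule linearI)
    fix x y
    show "p (x + y) = p x + p y"
      using sublinear_add[OF p, of x y] sublinear_add[OF p, of "- x" "- y"] neg[of x] neg[of y]
        neg[of "x + y"] by simp
  next
    fix r :: real and x
    show "p (r *\<^sub>R x) = r *\<^sub>R p x"
    proof (cases "r \<ge> 0")
      case True then show ?thesis using sublinear_scale[OF p] by simp
    next
      case False
      then have "p ((- r) *\<^sub>R x) = - r * p x" using sublinear_scale[OF p, of "- r" x] by simp
      then show ?thesis using neg[of "r *\<^sub>R x"] by simp
    qed
  qed
qed

text \<open>
  The lower bound is the pointwise infimum.  It is finite because \<open>- r (- x)\<close> bounds every member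
  at \<open>x\<close>; it is subadditive because of two members of a chain the smaller one can be used for both
  summands.
\<close>

lemma sublinear_chain_inf:
  fixes C :: "('a::real_vector \<Rightarrow> real) set"
  assumes "C \<noteq> {}" and sub: "\<And>p. p \<in> C \<Longrightarrow> sublinear p"
    and chain: "\<And>p q. p \<in> C \<Longrightarrow> q \<in> C \<Longrightarrow> p \<le> q \<or> q \<le> p"
    and le: "\<And>p. p \<in> C \<Longrightarrow> p \<le> r" and r: "sublinear r"
  obtains m where "sublinear m" "\<And>p. p \<in> C \<Longrightarrow> m \<le> p"
proof
  define m where "m x = (INF p\<in>C. p x)" for x
  have "- r (- x) \<le> p x" if "p \<in> C" for p x
    using sublinear_lower[OF sub[OF that], of x] le_funD[OF le[OF that], of "- x"] by simp
  then have bdd: "bdd_below ((\<lambda>p. p x) ` C)" for x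
    by (intro bdd_belowI2[where m = "- r (- x)"])
  have m_le: "m x \<le> p x" if "p \<in> C" for p x
    unfolding m_def using that by (intro cINF_lower bdd) auto
  have le_m: "c \<le> m x" if "\<And>p. p \<in> C \<Longrightarrow> c \<le> p x" for c x
    unfolding m_def using that \<open>C \<noteq> {}\<close> by (intro cINF_greatest) auto
  show "sublinear m"
    unfolding sublinear_def
  proof (intro conjI allI impI)
    fix x y
    have "m (x + y) \<le> p x + q y" if "p \<in> C" "q \<in> C" for p q
      using chain[OF that] m_le[OF that(1), of "x + y"] m_le[OF that(2), of "x + y"]
        sublinear_add[OF sub[OF that(1)], of x y] sublinear_add[OF sub[OF that(2)], of x y]
      by (auto simp: le_fun_def) (smt (verit))+
    then have "m (x + y) - q y \<le> m x" if "q \<in> C" for q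
      using that by (intro le_m) (simp add: algebra_simps)
    then have "m (x + y) - m x \<le> m y"
      by (intro le_m) (simp add: algebra_simps)
    then show "m (x + y) \<le> m x + m y" by simp
  next
    fix s :: real and x assume s: "s > 0"
    have "m (s *\<^sub>R x) / s \<le> p x" if "p \<in> C" for p
      using m_le[OF that, of "s *\<^sub>R x"] sublinear_scale[OF sub[OF that], of s x] s
      by (simp add: field_simps)
    then have "m (s *\<^sub>R x) / s \<le> m x" by (rule le_m)
    then show "m (s *\<^sub>R x) \<le> s * m x" using s by (simp add: field_simps)
  qed
  show "m \<le> p" if "p \<in> C" for p using m_le[OF that] by (simp add: le_fun_def)
qed

lemma linear_below_sublinear:
  fixes r :: "'a::real_vector \<Rightarrow> real"
  assumes r: "sublinear r"
  obtains g where "linear g" "\<And>x. g x \<le> r x"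
proof -
  define A where "A = {p. sublinear p \<and> p \<le> r}"
  \<comment> \<open>The order is reversed, so that a maximal element is a minimal sublinear functional.\<close>
  have po: "partial_order_on A (relation_of (\<lambda>p q. q \<le> p) A)"
    unfolding partial_order_on_def preorder_on_def refl_on_def trans_def antisym_def relation_of_def
    by auto
  have ch: "\<exists>u\<in>A. \<forall>a\<in>C. u \<le> a" if "C \<in> Chains (relation_of (\<lambda>p q. q \<le> p) A)" for C
  proof (cases "C = {}")
    case True
    then show ?thesis using r by (auto simp: A_def)
  next
    case False
    have C: "p \<in> A" "p \<le> q \<or> q \<le> p" if "p \<in> C" "q \<in> C" for p q
      using that \<open>C \<in> _\<close> unfolding Chains_def relation_of_def by auto
    obtain m where m: "sublinear m" "\<And>p. p \<in> C \<Longrightarrow> m \<le> p"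
      using sublinear_chain_inf[OF False _ _ _ r] C by (auto simp: A_def)
    moreover obtain p where "p \<in> C" using False by auto
    ultimately have "m \<in> A" using C(1)[of p p] order.trans[of m p r] by (auto simp: A_def)
    then show ?thesis using m by auto
  qed
  obtain p where p: "p \<in> A" "\<And>q. q \<in> A \<Longrightarrow> q \<le> p \<Longrightarrow> q = p"
    using predicate_Zorn[OF po ch] by blast
  have "linear p"
  proof (rule minimal_sublinear_linear)
    show "sublinear p" using p by (simp add: A_def)
    show "q = p" if "sublinear q" "\<And>x. q x \<le> p x" for q
      using p that order.trans[of q p r] by (auto simp: A_def le_fun_def)
  qed
  then show thesis using that p(1) by (auto simp: A_def le_fun_def)
qed

text \<open>
  A linear functional below the modification of the norm in direction \<open>e\<close> has norm at most \<open>1\<close>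
  and takes at \<open>- e\<close> a value of at most \<open>- norm e\<close>.
\<close>

lemma norming_functional:
  fixes e :: "'a::real_normed_vector"
  obtains g :: "'a \<Rightarrow>\<^sub>L real" where "norm g \<le> 1" "norm e \<le> blinfun_apply g e"
proof -
  have "sublinear (norm :: 'a \<Rightarrow> real)" by (simp add: sublinear_def norm_triangle_ineq)
  then obtain q where q: "sublinear q" "\<And>x::'a. q x \<le> norm x" "q (- e) \<le> - norm e"
    using sublinear_modification by blast
  obtain g where g: "linear g" "\<And>x. g x \<le> q x"
    using linear_below_sublinear[OF q(1)] by blast
  have ab: "norm (g x) \<le> norm x * 1" for x
    using g(2)[of x] q(2)[of x] g(2)[of "- x"] q(2)[of "- x"] linear_neg[OF g(1), of x] by simp
  have bl: "bounded_linear g"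
    using g(1) ab by (intro bounded_linear.intro bounded_linear_axioms.intro exI[of _ 1]) auto
  show thesis
  proof
    show "norm (Blinfun g) \<le> 1"
      using ab by (intro norm_blinfun_bound) (auto simp: bounded_linear_Blinfun_apply[OF bl])
    show "norm e \<le> blinfun_apply (Blinfun g) e"
      using g(2)[of "- e"] q(3) linear_neg[OF g(1), of e]
      by (simp add: bounded_linear_Blinfun_apply[OF bl])
  qed
qed

lemma canonical_apply [simp]: "blinfun_apply (canonical e) g = blinfun_apply g e"
  unfolding canonical_def
  by (simp add: bounded_linear_Blinfun_apply bounded_linear_intros)

lemma bounded_linear_canonical: "bounded_linear canonical"
proof (rule bounded_linear_intro[where K = 1])
  show "norm (canonical x) \<le> norm x * 1" for x :: 'a
  proof (rule norm_blinfun_bound)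
    show "norm (blinfun_apply (canonical x) g) \<le> norm x * 1 * norm g" for g :: "'a \<Rightarrow>\<^sub>L real"
      using norm_blinfun[of g x] by (simp add: mult.commute)
  qed simp
qed (auto intro!: blinfun_eqI simp: blinfun.add_right blinfun.scaleR_right blinfun.add_left blinfun.scaleR_left)

lemmas linear_canonical = bounded_linear.linear[OF bounded_linear_canonical]

text \<open>
  Together with the trivial estimate this makes the canonical embedding isometric, so that Cauchy
  sequences in its image come from Cauchy sequences in the space.
\<close>

lemma norm_canonical_ge: "norm e \<le> norm (canonical e)"
proof -
  obtain g where g: "norm g \<le> 1" "norm e \<le> blinfun_apply g e"
    using norming_functional .
  have "norm e \<le> norm (blinfun_apply (canonical e) g)" using g by simp
  also have "\<dots> \<le> norm (canonical e) * norm g" by (rule norm_blinfun)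
  also have "\<dots> \<le> norm (canonical e)" using g by (simp add: mult_left_le)
  finally show ?thesis .
qed


section \<open>Uniform boundedness on complete carriers\<close>

definition seminorm_on :: "'a::real_vector set \<Rightarrow> ('a \<Rightarrow> real) \<Rightarrow> bool"
  where "seminorm_on X p \<longleftrightarrow>
    (\<forall>x\<in>X. \<forall>y\<in>X. p (x + y) \<le> p x + p y) \<and> (\<forall>r. \<forall>x\<in>X. p (r *\<^sub>R x) = \<bar>r\<bar> * p x)"

definition complete_carrier :: "'a::real_vector set \<Rightarrow> ('a \<Rightarrow> real) \<Rightarrow> bool"
  where "complete_carrier X nX \<longleftrightarrow>
    (\<forall>s. (\<forall>n::nat. s n \<in> X) \<and> (\<forall>\<epsilon>>0. \<exists>M. \<forall>m\<ge>M. \<forall>n\<ge>M. nX (s m - s n) < \<epsilon>) \<longrightarrow>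
      (\<exists>x\<in>X. (\<lambda>n. nX (s n - x)) \<longlonglongrightarrow> 0))"

lemma seminorm_onD:
  assumes "seminorm_on X p"
  shows "x \<in> X \<Longrightarrow> y \<in> X \<Longrightarrow> p (x + y) \<le> p x + p y"
    and "x \<in> X \<Longrightarrow> p (r *\<^sub>R x) = \<bar>r\<bar> * p x"
  using assms by (auto simp: seminorm_on_def)

lemma seminorm_on_minus: "seminorm_on X p \<Longrightarrow> x \<in> X \<Longrightarrow> p (- x) = p x"
  using seminorm_onD(2)[of X p x "- 1"] by simp

lemma seminorm_on_nonneg:
  assumes "seminorm_on X p" "subspace X" "x \<in> X"
  shows "0 \<le> p x"
  using seminorm_onD(1)[OF assms(1,3) subspace_neg[OF assms(2,3)]] seminorm_on_minus[OF assms(1,3)]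
    seminorm_onD(2)[OF assms(1,3), of 0] by simp

lemma seminorm_on_diff:
  assumes "seminorm_on X p" "subspace X" "x \<in> X" "y \<in> X"
  shows "p (x - y) \<le> p x + p y"
  using seminorm_onD(1)[OF assms(1,3) subspace_neg[OF assms(2,4)]] seminorm_on_minus[OF assms(1,4)]
  by simp

lemma seminorm_on_commute:
  assumes "seminorm_on X p" "subspace X" "x \<in> X" "y \<in> X"
  shows "p (x - y) = p (y - x)"
  using seminorm_on_minus[OF assms(1) subspace_diff[OF assms(2-4)]] by simp

text \<open>
  A ball around an arbitrary centre contains points where a seminorm is at least as large as on the
  ball of the same radius around \<open>0\<close>, because \<open>2 * p w \<le> p (x + w) + p (x - w)\<close>.
\<close>

lemma seminorm_large_in_ball:
  assumes X: "subspace X" and nX: "seminorm_on X nX" and p: "seminorm_on X p"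
    and u: "u \<in> X" "c * nX u < p u" and c: "c \<ge> 0" and K: "p u \<le> K * nX u"
    and x: "x \<in> X" and r: "r > 0"
  obtains y where "y \<in> X" "nX (y - x) \<le> r" "c * r \<le> p y"
proof -
  have "nX u > 0"
    using seminorm_on_nonneg[OF nX X u(1)] u(2) K by (cases "nX u = 0") auto
  define w where "w = (r / nX u) *\<^sub>R u"
  have w: "w \<in> X" using X u(1) by (simp add: w_def subspace_scale)
  have nw: "nX w = r"
    using seminorm_onD(2)[OF nX u(1)] \<open>nX u > 0\<close> r by (simp add: w_def)
  have pw: "c * r \<le> p w"
    using seminorm_onD(2)[OF p u(1)] \<open>nX u > 0\<close> r u(2) by (simp add: w_def field_simps)
  have "(x + w) - (x - w) = 2 *\<^sub>R w" by (simp add: scaleR_2)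
  then have "2 * p w \<le> p (x + w) + p (x - w)"
    using seminorm_on_diff[OF p X, of "x + w" "x - w"] seminorm_onD(2)[OF p w, of 2] X x w
    by (simp add: subspace_add subspace_diff)
  then have "c * r \<le> p (x + w) \<or> c * r \<le> p (x - w)" using pw by linarith
  then show thesis
  proof
    assume "c * r \<le> p (x + w)"
    then show thesis using that[of "x + w"] X x w nw by (simp add: subspace_add)
  next
    assume "c * r \<le> p (x - w)"
    then show thesis using that[of "x - w"] X x w nw seminorm_on_minus[OF nX w]
      by (simp add: subspace_diff)
  qed
qed

text \<open>
  Sokal's argument.  If the seminorms are not uniformly bounded, some of them admit only constants
  of at least \<open>4 ^ k\<close>.  Moving by at most \<open>(1/3) ^ k\<close> in step \<open>k\<close>, one makes the \<open>k\<close>-th chosen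
  seminorm as large as \<open>2/3\<close> of its constant times \<open>(1/3) ^ k\<close>; all later steps together have length
  at most \<open>1/2 * (1/3) ^ k\<close> and destroy only a part of this.  At the limit point the chosen
  seminorms grow like \<open>(4/3) ^ k\<close>.  The factor \<open>2/3\<close> leaves room
  because a best constant need not be attained.
\<close>

theorem uniform_boundedness_on:
  fixes p :: "nat \<Rightarrow> 'a::real_vector \<Rightarrow> real"
  assumes X: "subspace X" and nX: "seminorm_on X nX" and complete: "complete_carrier X nX"
    and p: "\<And>n. seminorm_on X (p n)"
    and cont: "\<And>n. \<exists>K. \<forall>x\<in>X. p n x \<le> K * nX x"
    and ptw: "\<And>x. x \<in> X \<Longrightarrow> \<exists>B. \<forall>n. p n x \<le> B"
  shows "\<exists>K\<ge>0. \<forall>n. \<forall>x\<in>X. p n x \<le> K * nX x"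
proof (rule ccontr)
  assume contr: "\<not> ?thesis"
  have nonneg: "0 \<le> nX x" if "x \<in> X" for x using seminorm_on_nonneg[OF nX X that] .
  have unbounded: "\<exists>n x. x \<in> X \<and> B * nX x < p n x" if "B \<ge> 0" for B
    using contr that by (metis not_less)
  have "\<exists>n N u. N \<ge> B \<and> (\<forall>x\<in>X. p n x \<le> N * nX x) \<and> u \<in> X \<and> (2/3) * N * nX u < p n u"
    if B: "B \<ge> 1" for B
  proof -
    have "\<exists>n x. x \<in> X \<and> B * nX x < p n x" using unbounded B by simp
    then obtain n x where x: "x \<in> X" "B * nX x < p n x" by blast
    define S where "S = {K. \<forall>x\<in>X. p n x \<le> K * nX x}"
    have low: "B \<le> K" if "K \<in> S" for K
    proof (rule ccontr)
      assume "\<not> B \<le> K"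
      then have "K * nX x \<le> B * nX x" using nonneg[OF x(1)] by (intro mult_right_mono) auto
      moreover have "p n x \<le> K * nX x" using that x(1) by (simp add: S_def)
      ultimately show False using x(2) by linarith
    qed
    have ne: "S \<noteq> {}" using cont[of n] by (auto simp: S_def)
    have bdd: "bdd_below S" using low by (rule bdd_belowI)
    have "B \<le> Inf S" using low ne by (intro cInf_greatest) auto
    then have "Inf S < (3/2) * Inf S" using B by simp
    then obtain N where N: "N \<in> S" "N < (3/2) * Inf S"
      using cInf_lessD[OF ne] by blast
    \<comment> \<open>\<open>N\<close> is an admissible constant and \<open>(2/3) * N\<close> is not.\<close>
    then have "(2/3) * N \<notin> S" using cInf_lower[OF _ bdd, of "(2/3) * N"] by force
    then obtain u where "u \<in> X" "(2/3) * N * nX u < p n u" by (force simp: S_def)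
    then show ?thesis using N low by (auto simp: S_def)
  qed
  then have "\<forall>k::nat. \<exists>n N u. N \<ge> 4 ^ k \<and> (\<forall>x\<in>X. p n x \<le> N * nX x) \<and> u \<in> X \<and> (2/3) * N * nX u < p n u"
    by simp
  then obtain n N u where N: "\<And>k. (4::real) ^ k \<le> N k" "\<And>k x. x \<in> X \<Longrightarrow> p (n k) x \<le> N k * nX x"
    and u: "\<And>k::nat. u k \<in> X" "\<And>k. (2/3) * N k * nX (u k) < p (n k) (u k)"
    by metis
  have Npos: "0 < N k" for k using N(1)[of k] by (smt (verit) zero_less_power)
  have "\<exists>y. y \<in> X \<and> nX (y - x) \<le> (1/3) ^ k \<and> (2/3) * N k * (1/3) ^ k \<le> p (n k) y"
    if "x \<in> X" for x k
  proof (rule seminorm_large_in_ball[OF X nX p u(1) u(2) _ _ that])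
    show "0 \<le> (2/3) * N k" using Npos[of k] by simp
    show "p (n k) (u k) \<le> N k * nX (u k)" by (rule N(2)[OF u(1)])
    show "0 < (1/3::real) ^ k" by simp
  qed blast
  then have "\<exists>s. \<forall>k. (s k \<in> X) \<and>
      (nX (s (Suc k) - s k) \<le> (1/3) ^ k \<and> (2/3) * N k * (1/3) ^ k \<le> p (n k) (s (Suc k)))"
    by (intro dependent_nat_choice) (use subspace_0[OF X] in blast)+
  then obtain s where s: "\<And>k. s k \<in> X" "\<And>k. nX (s (Suc k) - s k) \<le> (1/3) ^ k"
    "\<And>k. (2/3) * N k * (1/3) ^ k \<le> p (n k) (s (Suc k))" by blast
  have tail: "nX (s (k + j) - s k) \<le> (3/2) * (1/3) ^ k * (1 - (1/3) ^ j)" for k j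
  proof (induction j)
    case 0
    show ?case using seminorm_onD(2)[OF nX s(1), of 0 0] by simp
  next
    case (Suc j)
    have "nX (s (k + Suc j) - s k) = nX ((s (Suc (k + j)) - s (k + j)) + (s (k + j) - s k))" by simp
    also have "\<dots> \<le> nX (s (Suc (k + j)) - s (k + j)) + nX (s (k + j) - s k)"
      by (intro seminorm_onD(1)[OF nX] subspace_diff[OF X] s(1))
    also have "\<dots> \<le> (1/3) ^ (k + j) + (3/2) * (1/3) ^ k * (1 - (1/3) ^ j)"
      using s(2)[of "k + j"] Suc.IH by simp
    also have "\<dots> = (3/2) * (1/3) ^ k * (1 - (1/3) ^ Suc j)"
      by (simp add: power_add algebra_simps diff_divide_distrib)
    finally show ?case .
  qed
  have tail': "nX (s m - s k) \<le> (3/2) * (1/3) ^ k" if "k \<le> m" for k m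
  proof -
    obtain j where j: "m = k + j" using \<open>k \<le> m\<close> le_Suc_ex by blast
    have "(3/2) * (1/3) ^ k * (1 - (1/3) ^ j) \<le> (3/2) * (1/3 :: real) ^ k * 1"
      by (intro mult_left_mono) auto
    from order_trans[OF tail this] show ?thesis using j by simp
  qed
  have "(\<lambda>k. (3/2) * (1/3 :: real) ^ k) \<longlonglongrightarrow> 0"
    by (rule tendsto_mult_right_zero) (simp add: LIMSEQ_realpow_zero)
  have cauchy: "\<exists>M. \<forall>m\<ge>M. \<forall>l\<ge>M. nX (s m - s l) < \<epsilon>" if "\<epsilon> > 0" for \<epsilon>
  proof -
    have "eventually (\<lambda>k. (3/2) * (1/3 :: real) ^ k < \<epsilon>) sequentially"
      using \<open>_ \<longlonglongrightarrow> 0\<close> that by (rule order_tendstoD)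
    then obtain M where M: "\<And>k. k \<ge> M \<Longrightarrow> (3/2) * (1/3 :: real) ^ k < \<epsilon>"
      by (auto simp: eventually_sequentially)
    have "nX (s m - s l) < \<epsilon>" if "m \<ge> M" "l \<ge> M" for m l
    proof (cases "l \<le> m")
      case True
      then show ?thesis using tail'[of l m] M[OF that(2)] by simp
    next
      case False
      then show ?thesis
        using tail'[of m l] M[OF that(1)] seminorm_on_commute[OF nX X s(1) s(1), of l m] by simp
    qed
    then show ?thesis by blast
  qed
  then obtain x where x: "x \<in> X" "(\<lambda>k. nX (s k - x)) \<longlonglongrightarrow> 0"
    using complete s(1) unfolding complete_carrier_def by blast
  have dist_x: "nX (s k - x) \<le> (3/2) * (1/3) ^ k" for k
  proof (rule tendsto_lowerbound)
    show "(\<lambda>m. nX (s m - x) + (3/2) * (1/3) ^ k) \<longlonglongrightarrow> (3/2) * (1/3) ^ k"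
      using tendsto_add[OF x(2) tendsto_const] by simp
    show "\<forall>\<^sub>F m in sequentially. nX (s k - x) \<le> nX (s m - x) + (3/2) * (1/3) ^ k"
      using eventually_ge_at_top[of k]
    proof eventually_elim
      case (elim m)
      have "nX (s k - x) = nX ((s m - x) - (s m - s k))" by simp
      also have "\<dots> \<le> nX (s m - x) + nX (s m - s k)"
        by (intro seminorm_on_diff[OF nX X] subspace_diff[OF X] s(1) x(1))
      finally show ?case using tail'[OF elim] by simp
    qed
  qed simp
  have large: "(1/6) * (4/3) ^ k \<le> p (n k) x" for k
  proof -
    have "p (n k) (s (Suc k)) = p (n k) (x + (s (Suc k) - x))" by simp
    also have "\<dots> \<le> p (n k) x + p (n k) (s (Suc k) - x)"
      by (intro seminorm_onD(1)[OF p] subspace_diff[OF X] s(1) x(1))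
    also have "p (n k) (s (Suc k) - x) \<le> N k * nX (s (Suc k) - x)"
      by (intro N(2) subspace_diff[OF X] s(1) x(1))
    also have "\<dots> \<le> N k * ((3/2) * (1/3) ^ Suc k)"
      using Npos[of k] by (intro mult_left_mono dist_x) simp
    finally have "(2/3) * N k * (1/3) ^ k \<le> p (n k) x + (1/2) * N k * (1/3) ^ k"
      using s(3)[of k] by simp
    then have "(1/6) * N k * (1/3) ^ k \<le> p (n k) x" by (simp add: algebra_simps)
    moreover have "(1/6) * 4 ^ k * (1/3) ^ k \<le> (1/6) * N k * (1/3 :: real) ^ k"
      using N(1)[of k] by (intro mult_right_mono) auto
    ultimately show ?thesis by (simp add: power_divide)
  qed
  obtain B where B: "\<And>m. p m x \<le> B" using ptw[OF x(1)] by blast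
  obtain k where "6 * B < (4/3) ^ k" using real_arch_pow[of "4/3" "6 * B"] by auto
  then show False using large[of k] B[of "n k"] by simp
qed

lemma complete_carrier_closed:
  fixes X :: "'a::banach set"
  assumes "closed X"
  shows "complete_carrier X norm"
  unfolding complete_carrier_def
proof (intro allI impI, elim conjE)
  fix s :: "nat \<Rightarrow> 'a"
  assume s: "\<forall>n. s n \<in> X" and "\<forall>\<epsilon>>0. \<exists>M. \<forall>m\<ge>M. \<forall>n\<ge>M. norm (s m - s n) < \<epsilon>"
  then have "Cauchy s" by (simp add: Cauchy_def dist_norm)
  then obtain x where "s \<longlonglongrightarrow> x" using Cauchy_convergent convergent_def by blast
  then show "\<exists>x\<in>X. (\<lambda>n. norm (s n - x)) \<longlonglongrightarrow> 0"
    using closed_sequentially[OF assms, of s] s LIM_zero tendsto_norm_zero by blast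
qed

lemma seminorm_on_norm: "seminorm_on X norm"
  by (simp add: seminorm_on_def norm_triangle_ineq)


section \<open>The spaces \<open>Y(J)\<close>\<close>

lemma Y_space_coeff: "c \<in> Y_space b J \<Longrightarrow> i \<notin> J \<Longrightarrow> c i = 0"
  by (simp add: Y_space_def coeffs_on_def)

lemma subspace_Y_space: "subspace (Y_space b J)"
  unfolding subspace_def Y_space_def coeffs_on_def
  by (auto simp: scaleR_fun_def scaleR_add_left summable_add
      simp flip: scaleR_scaleR intro: summable_scaleR_right)

lemma Y_norm_ge:
  assumes "c \<in> Y_space b J"
  shows "norm (\<Sum>i<N. c i *\<^sub>R b i) \<le> Y_norm b c"
proof -
  have "Bseq (\<lambda>N. \<Sum>i<N. c i *\<^sub>R b i)"
    using assms by (auto simp: Y_space_def summable_iff_convergent intro: convergent_imp_Bseq)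
  then have "bdd_above (range (\<lambda>N. norm (\<Sum>i<N. c i *\<^sub>R b i)))"
    by (auto simp: Bseq_def intro: bdd_aboveI)
  then show ?thesis unfolding Y_norm_def by (rule cSUP_upper[OF UNIV_I])
qed

lemma Y_norm_le: "(\<And>N. norm (\<Sum>i<N. c i *\<^sub>R b i) \<le> K) \<Longrightarrow> Y_norm b c \<le> K"
  unfolding Y_norm_def by (rule cSUP_least) auto

lemma seminorm_on_Y_norm: "seminorm_on (Y_space b J) (Y_norm b)"
  unfolding seminorm_on_def
proof (intro conjI ballI allI)
  fix c d assume c: "c \<in> Y_space b J" and d: "d \<in> Y_space b J"
  show "Y_norm b (c + d) \<le> Y_norm b c + Y_norm b d"
  proof (rule Y_norm_le)
    fix N
    have "norm (\<Sum>i<N. (c + d) i *\<^sub>R b i) = norm ((\<Sum>i<N. c i *\<^sub>R b i) + (\<Sum>i<N. d i *\<^sub>R b i))"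
      by (simp add: scaleR_add_left sum.distrib)
    also have "\<dots> \<le> Y_norm b c + Y_norm b d"
      using Y_norm_ge[OF c, of N] Y_norm_ge[OF d, of N] norm_triangle_le by (meson add_mono order_trans)
    finally show "norm (\<Sum>i<N. (c + d) i *\<^sub>R b i) \<le> Y_norm b c + Y_norm b d" .
  qed
next
  fix r c assume c: "c \<in> Y_space b J"
  have le: "Y_norm b (s *\<^sub>R e) \<le> \<bar>s\<bar> * Y_norm b e" if e: "e \<in> Y_space b J" for s e
  proof (rule Y_norm_le)
    fix N
    have "(\<Sum>i<N. (s *\<^sub>R e) i *\<^sub>R b i) = s *\<^sub>R (\<Sum>i<N. e i *\<^sub>R b i)"
      by (simp add: scaleR_fun_def scaleR_right.sum)
    then show "norm (\<Sum>i<N. (s *\<^sub>R e) i *\<^sub>R b i) \<le> \<bar>s\<bar> * Y_norm b e"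
      using Y_norm_ge[OF e, of N] by (simp add: mult_left_mono)
  qed
  have "\<bar>r\<bar> * Y_norm b c \<le> Y_norm b (r *\<^sub>R c)" if "r \<noteq> 0"
    using le[OF subspace_scale[OF subspace_Y_space c], of "inverse r" r] that
    by (simp add: field_simps)
  moreover have "0 \<le> Y_norm b (0 *\<^sub>R c)"
    using Y_norm_ge[OF subspace_scale[OF subspace_Y_space c, of 0], of 0] by simp
  ultimately show "Y_norm b (r *\<^sub>R c) = \<bar>r\<bar> * Y_norm b c"
    using le[OF c, of r] by (cases "r = 0") auto
qed

lemmas Y_norm_nonneg = seminorm_on_nonneg[OF seminorm_on_Y_norm subspace_Y_space]

lemma Y_norm_coeff:
  assumes "c \<in> Y_space b J"
  shows "\<bar>c i\<bar> * norm (b i) \<le> 2 * Y_norm b c"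
proof -
  have "\<bar>c i\<bar> * norm (b i) = norm ((\<Sum>k<Suc i. c k *\<^sub>R b k) - (\<Sum>k<i. c k *\<^sub>R b k))" by simp
  also have "\<dots> \<le> Y_norm b c + Y_norm b c"
    by (intro norm_triangle_le_diff add_mono Y_norm_ge[OF assms])
  finally show ?thesis by simp
qed

text \<open>
  As the vectors \<open>b i\<close> do not vanish, the coordinates of a Cauchy sequence converge; and since the
  norm dominates all partial sums at once, the partial sums converge uniformly in their length, so
  that the limit sequence again gives a convergent series.
\<close>

lemma complete_Y_space:
  fixes b :: "nat \<Rightarrow> 'f::banach"
  assumes nz: "\<And>i. i \<in> J \<Longrightarrow> b i \<noteq> 0"
  shows "complete_carrier (Y_space b J) (Y_norm b)"
  unfolding complete_carrier_def
proof (intro allI impI, elim conjE)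
  fix s :: "nat \<Rightarrow> nat \<Rightarrow> real"
  assume s: "\<forall>n. s n \<in> Y_space b J"
    and cauchy: "\<forall>\<epsilon>>0. \<exists>M. \<forall>m\<ge>M. \<forall>n\<ge>M. Y_norm b (s m - s n) < \<epsilon>"
  have dY: "s m - s n \<in> Y_space b J" for m n using s subspace_Y_space subspace_diff by blast
  have "convergent (\<lambda>n. s n i)" for i
  proof (cases "i \<in> J")
    case False
    then have "s n i = 0" for n using Y_space_coeff s by blast
    then show ?thesis by (simp add: convergent_const)
  next
    case True
    have "Cauchy (\<lambda>n. s n i)"
    proof (rule metric_CauchyI)
      fix \<epsilon> :: real assume "\<epsilon> > 0"
      then have "\<epsilon> * norm (b i) / 2 > 0" using nz[OF True] by simp
      then obtain M where M: "\<forall>m\<ge>M. \<forall>n\<ge>M. Y_norm b (s m - s n) < \<epsilon> * norm (b i) / 2"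
        using cauchy by blast
      have "dist (s m i) (s n i) < \<epsilon>" if "m \<ge> M" "n \<ge> M" for m n
      proof -
        have "Y_norm b (s m - s n) < \<epsilon> * norm (b i) / 2" using M that by blast
        then have "\<bar>s m i - s n i\<bar> * norm (b i) < \<epsilon> * norm (b i)"
          using Y_norm_coeff[OF dY, of m n i] by simp
        then show ?thesis using nz[OF True] by (simp add: dist_real_def mult_less_cancel_right_disj)
      qed
      then show "\<exists>M. \<forall>m\<ge>M. \<forall>n\<ge>M. dist (s m i) (s n i) < \<epsilon>" by blast
    qed
    then show ?thesis by (simp add: Cauchy_convergent_iff)
  qed
  then obtain c where c: "\<And>i. (\<lambda>n. s n i) \<longlonglongrightarrow> c i" unfolding convergent_def by metis
  have close: "\<exists>M. \<forall>m\<ge>M. \<forall>N. norm ((\<Sum>i<N. s m i *\<^sub>R b i) - (\<Sum>i<N. c i *\<^sub>R b i)) \<le> \<epsilon>"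
    if "\<epsilon> > 0" for \<epsilon>
  proof -
    obtain M where M: "\<forall>m\<ge>M. \<forall>n\<ge>M. Y_norm b (s m - s n) < \<epsilon>"
      using cauchy \<open>\<epsilon> > 0\<close> by blast
    have "norm ((\<Sum>i<N. s m i *\<^sub>R b i) - (\<Sum>i<N. c i *\<^sub>R b i)) \<le> \<epsilon>" if "m \<ge> M" for m N
    proof (rule tendsto_upperbound)
      show "(\<lambda>n. norm ((\<Sum>i<N. s m i *\<^sub>R b i) - (\<Sum>i<N. s n i *\<^sub>R b i))) \<longlonglongrightarrow>
          norm ((\<Sum>i<N. s m i *\<^sub>R b i) - (\<Sum>i<N. c i *\<^sub>R b i))"
        by (intro tendsto_intros c)
      show "\<forall>\<^sub>F n in sequentially. norm ((\<Sum>i<N. s m i *\<^sub>R b i) - (\<Sum>i<N. s n i *\<^sub>R b i)) \<le> \<epsilon>"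
        using eventually_ge_at_top[of M]
      proof eventually_elim
        case (elim n)
        have "norm ((\<Sum>i<N. s m i *\<^sub>R b i) - (\<Sum>i<N. s n i *\<^sub>R b i))
            = norm (\<Sum>i<N. (s m - s n) i *\<^sub>R b i)"
          by (simp add: scaleR_diff_left sum_subtractf)
        also have "\<dots> \<le> Y_norm b (s m - s n)" by (rule Y_norm_ge[OF dY])
        also have "\<dots> < \<epsilon>" using M that elim by blast
        finally show ?case by simp
      qed
    qed simp
    then show ?thesis by blast
  qed
  have "Cauchy (\<lambda>N. \<Sum>i<N. c i *\<^sub>R b i)"
  proof (rule CauchyI)
    fix \<epsilon> :: real assume e: "\<epsilon> > 0"
    then obtain m where m: "\<And>N. norm ((\<Sum>i<N. s m i *\<^sub>R b i) - (\<Sum>i<N. c i *\<^sub>R b i)) \<le> \<epsilon> / 3"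
      using close[of "\<epsilon> / 3"] by auto
    have cs: "Cauchy (\<lambda>N. \<Sum>i<N. s m i *\<^sub>R b i)"
      using s by (auto simp: Y_space_def summable_iff_convergent Cauchy_convergent_iff)
    obtain M where M: "\<forall>k\<ge>M. \<forall>l\<ge>M. norm ((\<Sum>i<k. s m i *\<^sub>R b i) - (\<Sum>i<l. s m i *\<^sub>R b i)) < \<epsilon> / 3"
      using CauchyD[OF cs, of "\<epsilon> / 3"] e by auto
    have "norm ((\<Sum>i<k. c i *\<^sub>R b i) - (\<Sum>i<l. c i *\<^sub>R b i)) < \<epsilon>" if "k \<ge> M" "l \<ge> M" for k l
    proof -
      let ?s = "\<lambda>k. \<Sum>i<k. s m i *\<^sub>R b i" and ?c = "\<lambda>k. \<Sum>i<k. c i *\<^sub>R b i"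
      have "norm (?c k - ?c l) = norm ((?s k - ?s l) - (?s k - ?c k) + (?s l - ?c l))" by simp
      also have "\<dots> \<le> norm (?s k - ?s l) + norm (?s k - ?c k) + norm (?s l - ?c l)"
        using norm_triangle_ineq[of "(?s k - ?s l) - (?s k - ?c k)" "?s l - ?c l"]
          norm_triangle_ineq4[of "?s k - ?s l" "?s k - ?c k"] by linarith
      also have "\<dots> < \<epsilon>"
        using M[rule_format, OF that] m[of k] m[of l] by linarith
      finally show ?thesis .
    qed
    then show "\<exists>M. \<forall>k\<ge>M. \<forall>l\<ge>M. norm ((\<Sum>i<k. c i *\<^sub>R b i) - (\<Sum>i<l. c i *\<^sub>R b i)) < \<epsilon>"
      by blast
  qed
  moreover have "c i = 0" if "i \<notin> J" for i
    using c[of i] Y_space_coeff[OF spec[OF s] that] by (simp add: LIMSEQ_const_iff)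
  ultimately have cY: "c \<in> Y_space b J"
    by (simp add: Y_space_def coeffs_on_def summable_iff_convergent Cauchy_convergent_iff)
  have "(\<lambda>n. Y_norm b (s n - c)) \<longlonglongrightarrow> 0"
  proof (rule LIMSEQ_I)
    fix \<epsilon> :: real assume e: "\<epsilon> > 0"
    then obtain M where M: "\<And>m N. m \<ge> M \<Longrightarrow>
        norm ((\<Sum>i<N. s m i *\<^sub>R b i) - (\<Sum>i<N. c i *\<^sub>R b i)) \<le> \<epsilon> / 2"
      using close[of "\<epsilon> / 2"] by auto
    have "norm (Y_norm b (s m - c) - 0) < \<epsilon>" if "m \<ge> M" for m
    proof -
      have "Y_norm b (s m - c) \<le> \<epsilon> / 2"
        using M[OF that] by (intro Y_norm_le) (simp add: scaleR_diff_left sum_subtractf)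
      moreover have "0 \<le> Y_norm b (s m - c)"
        by (rule Y_norm_nonneg[OF subspace_diff[OF subspace_Y_space spec[OF s] cY]])
      ultimately show ?thesis using e by simp
    qed
    then show "\<exists>M. \<forall>m\<ge>M. norm (Y_norm b (s m - c) - 0) < \<epsilon>" by blast
  qed
  then show "\<exists>x\<in>Y_space b J. (\<lambda>n. Y_norm b (s n - x)) \<longlonglongrightarrow> 0" using cY by blast
qed

lemma L2_set_scale: "L2_set (\<lambda>i. r * a i) A = \<bar>r\<bar> * L2_set a A"
  by (simp add: L2_set_def power_mult_distrib real_sqrt_mult flip: sum_distrib_left)

lemma L2_set_le_sqrt_suminf:
  assumes "summable (\<lambda>i::nat. (a i)\<^sup>2)"
  shows "L2_set a {..<N} \<le> sqrt (\<Sum>i. (a i)\<^sup>2)"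
  unfolding L2_set_def using sum_le_suminf[OF assms, of "{..<N}"] by simp

text \<open>
  This turns the qualitative Besselian property into an estimate: the \<open>\<ell>\<^sup>2\<close>-norms of the initial
  segments of the coefficients are continuous seminorms, and square summability bounds them
  pointwise.
\<close>

lemma L2_set_uniformly_bounded:
  fixes \<alpha> :: "nat \<Rightarrow> 'a::real_vector \<Rightarrow> real"
  assumes X: "subspace X" and nX: "seminorm_on X nX" and complete: "complete_carrier X nX"
    and add: "\<And>i x y. x \<in> X \<Longrightarrow> y \<in> X \<Longrightarrow> \<alpha> i (x + y) = \<alpha> i x + \<alpha> i y"
    and scale: "\<And>i r x. x \<in> X \<Longrightarrow> \<alpha> i (r *\<^sub>R x) = r * \<alpha> i x"
    and cont: "\<And>i. \<exists>K. \<forall>x\<in>X. \<bar>\<alpha> i x\<bar> \<le> K * nX x"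
    and square: "\<And>x. x \<in> X \<Longrightarrow> summable (\<lambda>i. (\<alpha> i x)\<^sup>2)"
  shows "\<exists>K\<ge>0. \<forall>N. \<forall>x\<in>X. L2_set (\<lambda>i. \<alpha> i x) {..<N} \<le> K * nX x"
proof (rule uniform_boundedness_on[OF X nX complete])
  show "seminorm_on X (\<lambda>x. L2_set (\<lambda>i. \<alpha> i x) {..<N})" for N
    by (auto simp: seminorm_on_def add scale L2_set_triangle_ineq L2_set_scale)
  show "\<exists>B. \<forall>N. L2_set (\<lambda>i. \<alpha> i x) {..<N} \<le> B" if "x \<in> X" for x
    using L2_set_le_sqrt_suminf[OF square[OF that]] by blast
  fix N
  obtain K where K: "\<And>i x. x \<in> X \<Longrightarrow> \<bar>\<alpha> i x\<bar> \<le> K i * nX x" using cont by metis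
  have "L2_set (\<lambda>i. \<alpha> i x) {..<N} \<le> (\<Sum>i<N. K i) * nX x" if "x \<in> X" for x
  proof -
    have "L2_set (\<lambda>i. \<alpha> i x) {..<N} \<le> (\<Sum>i<N. \<bar>\<alpha> i x\<bar>)" by (rule L2_set_le_sum_abs)
    also have "\<dots> \<le> (\<Sum>i<N. K i * nX x)" using K[OF that] by (rule sum_mono)
    finally show ?thesis by (simp add: sum_distrib_right)
  qed
  then show "\<exists>K. \<forall>x\<in>X. L2_set (\<lambda>i. \<alpha> i x) {..<N} \<le> K * nX x" by blast
qed

lemma schauder_basis_nonzero:
  assumes "schauder_basis UNIV norm UNIV b"
  shows "b i \<noteq> 0"
proof
  assume "b i = 0"
  define a where "a k = (if k = i then 1 else 0 :: real)" for k
  have "expansion norm b a 0" "expansion norm b (\<lambda>_. 0) 0"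
    using \<open>b i = 0\<close> by (auto simp: expansion_def a_def sum.delta if_distrib[of "\<lambda>r. r *\<^sub>R _"] cong: if_cong)
  moreover have "a \<in> coeffs_on UNIV" "(\<lambda>_. 0) \<in> coeffs_on UNIV" by (auto simp: coeffs_on_def)
  ultimately have "a = (\<lambda>_. 0)" using assms unfolding schauder_basis_def by blast
  then have "a i = 0" by simp
  then show False by (simp add: a_def)
qed

text \<open>
  The members of \<open>Y(J)\<close> are exactly the coefficient families on \<open>J\<close> of expansions in the whole
  space, so the Besselian property applies to them.
\<close>

lemma besselian_Y_space:
  fixes b :: "nat \<Rightarrow> 'f::banach"
  assumes "besselian UNIV norm UNIV b" and c: "c \<in> Y_space b J"
  shows "summable (\<lambda>i. (c i)\<^sup>2)"
proof -
  have "(\<lambda>N. \<Sum>i<N. c i *\<^sub>R b i) \<longlonglongrightarrow> (\<Sum>i. c i *\<^sub>R b i)"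
    using c by (auto simp: Y_space_def intro: summable_LIMSEQ)
  from tendsto_norm_zero[OF LIM_zero[OF this]]
  have "expansion norm b c (\<Sum>i. c i *\<^sub>R b i)"
    by (simp add: expansion_def norm_minus_commute)
  then show ?thesis using assms(1) by (auto simp: besselian_def coeffs_on_def)
qed

lemma besselian_estimate:
  fixes b :: "nat \<Rightarrow> 'f::banach"
  assumes basis: "schauder_basis UNIV norm UNIV b" and bessel: "besselian UNIV norm UNIV b"
  shows "\<exists>K\<ge>0. \<forall>c\<in>Y_space b J. sqrt (\<Sum>i. (c i)\<^sup>2) \<le> K * Y_norm b c"
proof -
  note nz = schauder_basis_nonzero[OF basis]
  have "\<exists>K\<ge>0. \<forall>N. \<forall>c\<in>Y_space b J. L2_set (\<lambda>i. c i) {..<N} \<le> K * Y_norm b c"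
  proof (rule L2_set_uniformly_bounded[OF subspace_Y_space seminorm_on_Y_norm complete_Y_space])
    show "\<exists>K. \<forall>c\<in>Y_space b J. \<bar>c i\<bar> \<le> K * Y_norm b c" for i
    proof (intro exI ballI)
      fix c assume "c \<in> Y_space b J"
      then show "\<bar>c i\<bar> \<le> 2 / norm (b i) * Y_norm b c"
        using Y_norm_coeff[of c b J i] nz[of i] by (simp add: field_simps)
    qed
  qed (auto simp: nz besselian_Y_space[OF bessel] scaleR_fun_def)
  then obtain K where K: "K \<ge> 0" "\<And>N c. c \<in> Y_space b J \<Longrightarrow> L2_set c {..<N} \<le> K * Y_norm b c"
    by auto
  have "sqrt (\<Sum>i. (c i)\<^sup>2) \<le> K * Y_norm b c" if c: "c \<in> Y_space b J" for c
  proof (rule tendsto_upperbound)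
    show "(\<lambda>N. L2_set c {..<N}) \<longlonglongrightarrow> sqrt (\<Sum>i. (c i)\<^sup>2)"
      unfolding L2_set_def
      by (intro tendsto_real_sqrt summable_LIMSEQ besselian_Y_space[OF bessel c])
  qed (use K(2)[OF c] in auto)
  then show ?thesis using K(1) by blast
qed


section \<open>Duals of closed subspaces\<close>

lemma subspace_closure:
  fixes S :: "'a::real_normed_vector set"
  assumes S: "subspace S"
  shows "subspace (closure S)"
  unfolding subspace_def
proof (intro conjI ballI allI)
  show "0 \<in> closure S" using subspace_0[OF S] closure_subset by blast
next
  fix x y assume "x \<in> closure S" "y \<in> closure S"
  then obtain s t where "\<And>n. s n \<in> S" "s \<longlonglongrightarrow> x" "\<And>n. t n \<in> S" "t \<longlonglongrightarrow> y"
    by (metis closure_sequential)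
  then show "x + y \<in> closure S"
    unfolding closure_sequential
    by (intro exI[of _ "\<lambda>n. s n + t n"]) (auto intro: tendsto_add subspace_add[OF S])
next
  fix r x assume "x \<in> closure S"
  then obtain s where "\<And>n. s n \<in> S" "s \<longlonglongrightarrow> x" by (metis closure_sequential)
  then show "r *\<^sub>R x \<in> closure S"
    unfolding closure_sequential
    by (intro exI[of _ "\<lambda>n. r *\<^sub>R s n"]) (auto intro: tendsto_scaleR subspace_scale[OF S])
qed

lemma biorthogonal_expansion:
  assumes "schauder_basis X nX J v" "x \<in> X"
  shows "(\<lambda>i. biorthogonal X nX J v i x) \<in> coeffs_on J"
    and "expansion nX v (\<lambda>i. biorthogonal X nX J v i x) x"
proof -
  have "\<exists>!a. a \<in> coeffs_on J \<and> expansion nX v a x"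
    using assms by (simp add: schauder_basis_def)
  from theI'[OF this] show "(\<lambda>i. biorthogonal X nX J v i x) \<in> coeffs_on J"
    and "expansion nX v (\<lambda>i. biorthogonal X nX J v i x) x"
    using assms(2) by (simp_all add: biorthogonal_def)
qed

lemma biorthogonal_eqI:
  assumes "schauder_basis X nX J v" "x \<in> X" "a \<in> coeffs_on J" "expansion nX v a x"
  shows "biorthogonal X nX J v i x = a i"
proof -
  have "\<exists>!a. a \<in> coeffs_on J \<and> expansion nX v a x"
    using assms by (simp add: schauder_basis_def)
  then have "(THE a. a \<in> coeffs_on J \<and> expansion nX v a x) = a"
    using assms(3,4) by (intro the1_equality) auto
  then show ?thesis using assms(2) by (simp add: biorthogonal_def)
qed

lemma biorthogonal_basis_vector:
  assumes basis: "schauder_basis X norm J v" and j: "j \<in> J"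
  shows "biorthogonal X norm J v i (v j) = (if i = j then 1 else 0)"
proof (rule biorthogonal_eqI[OF basis])
  show "v j \<in> X" using basis j by (simp add: schauder_basis_def)
  show "(\<lambda>i. if i = j then 1 else 0) \<in> coeffs_on J" using j by (auto simp: coeffs_on_def)
  have "\<forall>\<^sub>F N in sequentially. norm (v j - (\<Sum>i<N. (if i = j then 1 else 0) *\<^sub>R v i)) = 0"
    using eventually_gt_at_top[of j]
    by eventually_elim (simp add: if_distrib[of "\<lambda>r. r *\<^sub>R _"] sum.delta cong: if_cong)
  then show "expansion norm v (\<lambda>i. if i = j then 1 else 0) (v j)"
    unfolding expansion_def by (rule tendsto_eventually)
qed

lemma basis_expansion_tendsto:
  fixes v :: "nat \<Rightarrow> 'a::real_normed_vector"
  assumes "expansion norm v a x"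
  shows "(\<lambda>N. \<Sum>i<N. a i *\<^sub>R v i) \<longlonglongrightarrow> x"
proof -
  have "(\<lambda>N. norm ((\<Sum>i<N. a i *\<^sub>R v i) - x)) \<longlonglongrightarrow> 0"
    using assms by (simp add: expansion_def norm_minus_commute)
  then show ?thesis by (simp add: LIM_zero_iff tendsto_norm_zero_iff)
qed

lemma dualI:
  assumes "\<And>x y. x \<in> X \<Longrightarrow> y \<in> X \<Longrightarrow> \<phi> (x + y) = \<phi> x + \<phi> y"
    and "\<And>r x. x \<in> X \<Longrightarrow> \<phi> (r *\<^sub>R x) = r * \<phi> x"
    and "\<And>x. x \<in> X \<Longrightarrow> \<bar>\<phi> x\<bar> \<le> K * nX x" and "\<And>x. x \<notin> X \<Longrightarrow> \<phi> x = 0"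
  shows "\<phi> \<in> dual X nX"
  using assms(1,2,4) exI[of "\<lambda>K. \<forall>x\<in>X. \<bar>\<phi> x\<bar> \<le> K * nX x" K] assms(3)
  unfolding dual_def bounded_linear_between_def by simp

lemma dualD:
  assumes "\<phi> \<in> dual X nX"
  shows "x \<in> X \<Longrightarrow> y \<in> X \<Longrightarrow> \<phi> (x + y) = \<phi> x + \<phi> y"
    and "x \<in> X \<Longrightarrow> \<phi> (r *\<^sub>R x) = r * \<phi> x"
    and "\<exists>K. \<forall>x\<in>X. \<bar>\<phi> x\<bar> \<le> K * nX x" and "x \<notin> X \<Longrightarrow> \<phi> x = 0"
  using assms unfolding dual_def bounded_linear_between_def by auto

lemma subspace_dual: "subspace (dual X nX)"
  unfolding subspace_def
proof (intro conjI ballI allI)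
  show "0 \<in> dual X nX" by (rule dualI[where K = 0]) auto
next
  fix \<phi> \<psi> assume p: "\<phi> \<in> dual X nX" "\<psi> \<in> dual X nX"
  obtain K L where "\<forall>x\<in>X. \<bar>\<phi> x\<bar> \<le> K * nX x" "\<forall>x\<in>X. \<bar>\<psi> x\<bar> \<le> L * nX x"
    using dualD(3)[OF p(1)] dualD(3)[OF p(2)] by blast
  then have "\<bar>\<phi> x + \<psi> x\<bar> \<le> (K + L) * nX x" if "x \<in> X" for x
    using that abs_triangle_ineq[of "\<phi> x" "\<psi> x"] by (fastforce simp: distrib_right)
  then show "\<phi> + \<psi> \<in> dual X nX"
    by (intro dualI[where K = "K + L"]) (simp_all add: dualD[OF p(1)] dualD[OF p(2)] algebra_simps)
next
  fix r \<phi> assume p: "\<phi> \<in> dual X nX"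
  obtain K where "\<forall>x\<in>X. \<bar>\<phi> x\<bar> \<le> K * nX x" using dualD(3)[OF p] by blast
  then have "\<bar>r\<bar> * \<bar>\<phi> x\<bar> \<le> \<bar>r\<bar> * K * nX x" if "x \<in> X" for x
    using that by (simp add: mult_left_mono mult.assoc)
  then show "r *\<^sub>R \<phi> \<in> dual X nX"
    by (intro dualI[where K = "\<bar>r\<bar> * K"])
      (simp_all add: scaleR_fun_def dualD[OF p] algebra_simps abs_mult)
qed

lemma dual_norm_bounds:
  assumes X: "subspace X" and p: "\<phi> \<in> dual X norm"
    and le: "\<And>x. x \<in> X \<Longrightarrow> \<bar>\<phi> x\<bar> \<le> c * norm x" and c: "c \<ge> 0"
  shows "0 \<le> dual_norm X norm \<phi>" "dual_norm X norm \<phi> \<le> c"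
proof -
  have le': "\<bar>\<phi> x\<bar> \<le> c" if "x \<in> {x \<in> X. norm x \<le> 1}" for x
    using that le[of x] c mult_left_le[of "norm x" c] by simp
  have z: "0 \<in> {x \<in> X. norm x \<le> 1}" using subspace_0[OF X] by simp
  show "dual_norm X norm \<phi> \<le> c"
    unfolding dual_norm_def using z le' by (intro cSUP_least) auto
  have "\<bar>\<phi> 0\<bar> \<le> dual_norm X norm \<phi>"
    unfolding dual_norm_def using z le' by (intro cSUP_upper bdd_aboveI2[where M = c]) auto
  then show "0 \<le> dual_norm X norm \<phi>" by simp
qed

lemma summable_product_of_squares:
  fixes a c :: "nat \<Rightarrow> real"
  assumes a: "summable (\<lambda>i. (a i)\<^sup>2)" and c: "summable (\<lambda>i. (c i)\<^sup>2)"
  shows "summable (\<lambda>i. a i * c i)"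
proof (rule summable_comparison_test')
  show "summable (\<lambda>i. (a i)\<^sup>2 + (c i)\<^sup>2)" using a c by (rule summable_add)
  show "norm (a i * c i) \<le> (a i)\<^sup>2 + (c i)\<^sup>2" if "i \<ge> 0" for i
    using sum_squares_bound[of "\<bar>a i\<bar>" "\<bar>c i\<bar>"] mult_nonneg_nonneg[of "\<bar>a i\<bar>" "\<bar>c i\<bar>"]
    unfolding real_norm_def abs_mult power2_abs by linarith
qed

lemma sum_product_le_L2:
  assumes c: "summable (\<lambda>i::nat. (c i)\<^sup>2)" and a: "L2_set a {..<N} \<le> K"
  shows "\<bar>\<Sum>i<N. a i * c i\<bar> \<le> K * sqrt (\<Sum>i. (c i)\<^sup>2)"
proof -
  have "\<bar>\<Sum>i<N. a i * c i\<bar> \<le> (\<Sum>i<N. \<bar>a i\<bar> * \<bar>c i\<bar>)"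
    by (rule order_trans[OF sum_abs]) (simp add: abs_mult)
  also have "\<dots> \<le> L2_set a {..<N} * L2_set c {..<N}" by (rule L2_set_mult_ineq)
  also have "\<dots> \<le> K * sqrt (\<Sum>i. (c i)\<^sup>2)"
    using a L2_set_le_sqrt_suminf[OF c, of N] order_trans[OF L2_set_nonneg a]
    by (intro mult_mono) auto
  finally show ?thesis .
qed


section \<open>Realizing the dual inside the space\<close>

text \<open>
  The situation at the base point, with \<open>X\<close> for the closed span \<open>X\<^sub>1\<close> of the derivatives and \<open>v\<close> for
  its basis.  The constant \<open>predual\<close> below is the space \<open>E\<^sub>1\<close>: a closed subspace of \<open>E\<close> that turns out
  to be a copy of the dual of \<open>X\<close>.
\<close>

locale realized_dual =
  fixes X :: "('e::banach \<Rightarrow>\<^sub>L real) set" and J :: "nat set" and v :: "nat \<Rightarrow> ('e \<Rightarrow>\<^sub>L real)"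
    and \<iota> :: "(('e \<Rightarrow>\<^sub>L real) \<Rightarrow> real) \<Rightarrow> (('e \<Rightarrow>\<^sub>L real) \<Rightarrow>\<^sub>L real)"
  assumes subspace_X: "subspace X" and closed_X: "closed X"
    and basis: "schauder_basis X norm J v"
    and shrinking: "shrinking X norm J v"
    and besselian: "besselian X norm J v"
    and identification: "bidual_identification X \<iota>"
    and realized: "\<And>i. i \<in> J \<Longrightarrow> \<iota> (biorthogonal X norm J v i) \<in> range canonical"
begin

abbreviation \<alpha> :: "nat \<Rightarrow> ('e \<Rightarrow>\<^sub>L real) \<Rightarrow> real"
  where "\<alpha> \<equiv> biorthogonal X norm J v"

definition predual :: "'e set"
  where "predual = closure (span {e. \<exists>i\<in>J. canonical e = \<iota> (\<alpha> i)})"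

definition restrict_X :: "(('e \<Rightarrow>\<^sub>L real) \<Rightarrow>\<^sub>L real) \<Rightarrow> ('e \<Rightarrow>\<^sub>L real) \<Rightarrow> real"
  where "restrict_X \<Phi> = (\<lambda>w. if w \<in> X then blinfun_apply \<Phi> w else 0)"

lemma alpha_outside: "i \<notin> J \<Longrightarrow> w \<in> X \<Longrightarrow> \<alpha> i w = 0"
  using biorthogonal_expansion(1)[OF basis] by (simp add: coeffs_on_def)

lemma alpha_in_dual: "\<alpha> i \<in> dual X norm"
proof (cases "i \<in> J")
  case True
  then show ?thesis using shrinking by (simp add: shrinking_def schauder_basis_def)
next
  case False
  then have "\<alpha> i = 0" using alpha_outside by (auto simp: fun_eq_iff biorthogonal_def)
  then show ?thesis using subspace_0[OF subspace_dual] by simp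
qed

lemma alpha_expansion: "w \<in> X \<Longrightarrow> (\<lambda>N. \<Sum>i<N. \<alpha> i w *\<^sub>R v i) \<longlonglongrightarrow> w"
  by (intro basis_expansion_tendsto biorthogonal_expansion[OF basis])

lemma alpha_square_summable: "w \<in> X \<Longrightarrow> summable (\<lambda>i. (\<alpha> i w)\<^sup>2)"
  using besselian biorthogonal_expansion[OF basis] by (auto simp: besselian_def)

text \<open>
  The coefficient functionals are continuous because a shrinking basis has its biorthogonal
  functionals in the dual.
\<close>

lemma alpha_estimate:
  "\<exists>L\<ge>0. \<forall>N. \<forall>w\<in>X. L2_set (\<lambda>i. \<alpha> i w) {..<N} \<le> L * norm w"
  by (rule L2_set_uniformly_bounded[OF subspace_X seminorm_on_norm complete_carrier_closed[OF closed_X]])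
    (auto simp: dualD[OF alpha_in_dual] alpha_square_summable)

lemma iota_add: "\<phi> \<in> dual X norm \<Longrightarrow> \<psi> \<in> dual X norm \<Longrightarrow> \<iota> (\<phi> + \<psi>) = \<iota> \<phi> + \<iota> \<psi>"
  and iota_scale: "\<phi> \<in> dual X norm \<Longrightarrow> \<iota> (r *\<^sub>R \<phi>) = r *\<^sub>R \<iota> \<phi>"
  and iota_apply: "\<phi> \<in> dual X norm \<Longrightarrow> w \<in> X \<Longrightarrow> blinfun_apply (\<iota> \<phi>) w = \<phi> w"
  and iota_bounded: "\<exists>K. \<forall>\<phi>\<in>dual X norm. norm (\<iota> \<phi>) \<le> K * dual_norm X norm \<phi>"
  using identification unfolding bidual_identification_def bounded_linear_between_def by auto

lemma iota_zero: "\<iota> 0 = 0"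
  using iota_scale[OF subspace_0[OF subspace_dual], of 0] by simp

lemma iota_diff:
  "\<phi> \<in> dual X norm \<Longrightarrow> \<psi> \<in> dual X norm \<Longrightarrow> \<iota> (\<phi> - \<psi>) = \<iota> \<phi> - \<iota> \<psi>"
  using iota_add[of \<phi> "- \<psi>"] iota_scale[of \<psi> "- 1"] subspace_neg[OF subspace_dual, of \<psi>]
  by simp

lemma iota_sum:
  assumes "\<And>i. i \<in> A \<Longrightarrow> \<phi> i \<in> dual X norm"
  shows "\<iota> (\<Sum>i\<in>A. a i *\<^sub>R \<phi> i) = (\<Sum>i\<in>A. a i *\<^sub>R \<iota> (\<phi> i))"
  using assms
proof (induction A rule: infinite_finite_induct)
  case (insert i A)
  have "(\<Sum>k\<in>A. a k *\<^sub>R \<phi> k) \<in> dual X norm" "a i *\<^sub>R \<phi> i \<in> dual X norm"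
    using insert.prems by (auto intro!: subspace_sum subspace_scale subspace_dual)
  then have "\<iota> (a i *\<^sub>R \<phi> i + (\<Sum>k\<in>A. a k *\<^sub>R \<phi> k)) = a i *\<^sub>R \<iota> (\<phi> i) + (\<Sum>k\<in>A. a k *\<^sub>R \<iota> (\<phi> k))"
    using insert by (simp only: iota_add iota_scale insertI1 insertI2)
  then show ?case by (simp only: sum.insert[OF insert.hyps])
qed (simp_all add: iota_zero)

lemma iota_estimate:
  "\<exists>K\<ge>0. \<forall>\<phi>\<in>dual X norm. \<forall>c\<ge>0. (\<forall>w\<in>X. \<bar>\<phi> w\<bar> \<le> c * norm w) \<longrightarrow> norm (\<iota> \<phi>) \<le> K * c"
proof -
  obtain K where K: "\<And>\<phi>. \<phi> \<in> dual X norm \<Longrightarrow> norm (\<iota> \<phi>) \<le> K * dual_norm X norm \<phi>"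
    using iota_bounded by blast
  have "norm (\<iota> \<phi>) \<le> \<bar>K\<bar> * c"
    if "\<phi> \<in> dual X norm" "c \<ge> 0" "\<And>w. w \<in> X \<Longrightarrow> \<bar>\<phi> w\<bar> \<le> c * norm w" for \<phi> c
  proof -
    have d: "0 \<le> dual_norm X norm \<phi>" "dual_norm X norm \<phi> \<le> c"
      using dual_norm_bounds[OF subspace_X that(1,3,2)] by auto
    have "K * dual_norm X norm \<phi> \<le> \<bar>K\<bar> * c"
      using d by (intro mult_mono) auto
    then show ?thesis using K[OF that(1)] by simp
  qed
  then show ?thesis by (intro exI[of _ "\<bar>K\<bar>"]) auto
qed

lemma restrict_X_bound: "\<bar>restrict_X \<Phi> w\<bar> \<le> norm \<Phi> * norm w"
  using norm_blinfun[of \<Phi> w] by (simp add: restrict_X_def)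

lemma restrict_X_in_dual: "restrict_X \<Phi> \<in> dual X norm"
  by (rule dualI[OF _ _ restrict_X_bound])
    (simp_all add: restrict_X_def blinfun.add_right blinfun.scaleR_right
      subspace_add[OF subspace_X] subspace_scale[OF subspace_X])

text \<open>
  Passing from \<open>e\<close> to its restriction to \<open>X\<close> and back to the bidual is the projection onto the
  image of \<open>E\<^sub>1\<close>.
\<close>

lemma bounded_linear_iota_restrict: "bounded_linear (\<lambda>e. \<iota> (restrict_X (canonical e)))"
proof -
  obtain K where "K \<ge> 0"
    and K: "\<forall>\<phi>\<in>dual X norm. \<forall>c\<ge>0. (\<forall>w\<in>X. \<bar>\<phi> w\<bar> \<le> c * norm w) \<longrightarrow> norm (\<iota> \<phi>) \<le> K * c"
    using iota_estimate by (elim exE conjE)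
  show ?thesis
  proof (rule bounded_linear_intro[where K = K])
    fix e d :: 'e and r :: real
    have "restrict_X (canonical (e + d)) = restrict_X (canonical e) + restrict_X (canonical d)"
      by (auto simp: restrict_X_def fun_eq_iff blinfun.add_right)
    then show "\<iota> (restrict_X (canonical (e + d))) = \<iota> (restrict_X (canonical e)) + \<iota> (restrict_X (canonical d))"
      by (simp add: iota_add restrict_X_in_dual)
    have "restrict_X (canonical (r *\<^sub>R e)) = r *\<^sub>R restrict_X (canonical e)"
      by (auto simp: restrict_X_def fun_eq_iff scaleR_fun_def blinfun.scaleR_right)
    then show "\<iota> (restrict_X (canonical (r *\<^sub>R e))) = r *\<^sub>R \<iota> (restrict_X (canonical e))"
      by (simp add: iota_scale restrict_X_in_dual)
    have "\<bar>restrict_X (canonical e) w\<bar> \<le> norm e * norm w" for w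
      using norm_blinfun[of w e] by (simp add: restrict_X_def mult.commute)
    then show "norm (\<iota> (restrict_X (canonical e))) \<le> norm e * K"
      using K[rule_format, OF restrict_X_in_dual, of "norm e"] by (simp add: mult.commute)
  qed
qed

lemma subspace_predual: "subspace predual"
  by (simp add: predual_def subspace_closure)

lemma closed_predual: "closed predual"
  by (simp add: predual_def)

text \<open>
  Both sides are continuous and linear in \<open>e\<close> and agree on the vectors that represent the
  biorthogonal functionals.  In particular, an element of \<open>E\<^sub>1\<close> is determined by its action on \<open>X\<close>.
\<close>

lemma canonical_eq_iota_restrict:
  assumes "e \<in> predual"
  shows "canonical e = \<iota> (restrict_X (canonical e))"
proof -
  let ?h = "\<lambda>e. canonical e - \<iota> (restrict_X (canonical e))"
  have bl: "bounded_linear ?h"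
    by (intro bounded_linear_sub bounded_linear_canonical bounded_linear_iota_restrict)
  \<comment> \<open>A generator is represented by its own biorthogonal functional.\<close>
  have gen: "?h e = 0" if e: "canonical e = \<iota> (\<alpha> i)" for e i
  proof -
    have "restrict_X (canonical e) = \<alpha> i"
      unfolding e using iota_apply[OF alpha_in_dual] dualD(4)[OF alpha_in_dual]
      by (auto simp: restrict_X_def fun_eq_iff)
    then show ?thesis using e by simp
  qed
  have "closed {e. ?h e = 0}"
    by (intro closed_Collect_eq linear_continuous_on[OF bl] continuous_on_const)
  moreover have "subspace {e. ?h e = 0}"
    using bounded_linear.linear[OF bl] by (rule linear_subspace_kernel)
  ultimately have "predual \<subseteq> {e. ?h e = 0}"
    unfolding predual_def using gen by (intro closure_minimal span_minimal) auto
  then show ?thesis using assms by auto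
qed

text \<open>
  Since the basis is shrinking, every functional is the norm limit of combinations of the
  biorthogonal ones, whose images come from \<open>E\<^sub>1\<close>; and the isometric image of the complete space
  \<open>E\<^sub>1\<close> is closed.
\<close>

lemma iota_in_canonical_predual:
  assumes p: "\<phi> \<in> dual X norm"
  shows "\<iota> \<phi> \<in> canonical ` predual"
proof -
  obtain a where a: "a \<in> coeffs_on J" "expansion (dual_norm X norm) \<alpha> a \<phi>"
    using biorthogonal_expansion[OF shrinking[unfolded shrinking_def] p] by (rule that)
  define e where "e i = inv canonical (\<iota> (\<alpha> i))" for i
  have e: "canonical (e i) = \<iota> (\<alpha> i)" if "i \<in> J" for i
    unfolding e_def by (rule f_inv_into_f[OF realized[OF that]])
  define s where "s N = (\<Sum>i<N. a i *\<^sub>R e i)" for N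
  define \<sigma> where "\<sigma> N = (\<Sum>i<N. a i *\<^sub>R \<alpha> i)" for N
  have \<sigma>: "\<sigma> N \<in> dual X norm" for N
    unfolding \<sigma>_def by (intro subspace_sum subspace_scale subspace_dual alpha_in_dual)
  have "a i *\<^sub>R e i \<in> predual" for i
  proof (cases "i \<in> J")
    case True
    then have "e i \<in> {e. \<exists>i\<in>J. canonical e = \<iota> (\<alpha> i)}" using e by auto
    then have "e i \<in> predual"
      unfolding predual_def by (intro subsetD[OF closure_subset] span_base)
    then show ?thesis by (rule subspace_scale[OF subspace_predual])
  next
    case False
    then show ?thesis using a(1) subspace_0[OF subspace_predual] by (simp add: coeffs_on_def)
  qed
  then have s: "s N \<in> predual" for N unfolding s_def by (intro subspace_sum subspace_predual)
  have "canonical (a i *\<^sub>R e i) = a i *\<^sub>R \<iota> (\<alpha> i)" for i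
    using e[of i] a(1)
    by (cases "i \<in> J") (auto simp: coeffs_on_def linear_canonical linear_scale linear_0)
  then have cs: "canonical (s N) = \<iota> (\<sigma> N)" for N
    unfolding s_def \<sigma>_def iota_sum[OF alpha_in_dual]
    by (simp only: linear_sum[OF linear_canonical])
  obtain K where K: "\<And>\<phi>. \<phi> \<in> dual X norm \<Longrightarrow> norm (\<iota> \<phi>) \<le> K * dual_norm X norm \<phi>"
    using iota_bounded by blast
  have "(\<lambda>N. \<iota> \<phi> - canonical (s N)) \<longlonglongrightarrow> 0"
  proof (rule Lim_null_comparison)
    show "\<forall>\<^sub>F N in sequentially. norm (\<iota> \<phi> - canonical (s N)) \<le> K * dual_norm X norm (\<phi> - \<sigma> N)"
      using K[OF subspace_diff[OF subspace_dual p \<sigma>]] by (simp add: cs iota_diff p \<sigma>)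
    show "(\<lambda>N. K * dual_norm X norm (\<phi> - \<sigma> N)) \<longlonglongrightarrow> 0"
      using a(2) unfolding expansion_def \<sigma>_def by (rule tendsto_mult_right_zero)
  qed
  from tendsto_diff[OF tendsto_const[of "\<iota> \<phi>"] this]
  have lim: "(\<lambda>N. canonical (s N)) \<longlonglongrightarrow> \<iota> \<phi>" by simp
  have "complete (canonical ` predual)"
    using closed_predual norm_canonical_ge
    by (intro complete_isometric_image[of 1, OF _ subspace_predual bounded_linear_canonical])
      (auto simp: complete_eq_closed)
  then have "closed (canonical ` predual)" by (rule complete_imp_closed)
  then show ?thesis
    by (rule closed_sequentially[of _ "\<lambda>N. canonical (s N)"]) (rule imageI[OF s], rule lim)
qed

lemma canonical_predual: "canonical ` predual = \<iota> ` dual X norm"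
proof
  show "canonical ` predual \<subseteq> \<iota> ` dual X norm"
  proof
    fix \<Phi> assume "\<Phi> \<in> canonical ` predual"
    then obtain e where "e \<in> predual" "\<Phi> = canonical e" by auto
    then show "\<Phi> \<in> \<iota> ` dual X norm"
      using canonical_eq_iota_restrict[of e] by (intro image_eqI[OF _ restrict_X_in_dual]) simp
  qed
  show "\<iota> ` dual X norm \<subseteq> canonical ` predual"
    by (auto intro!: iota_in_canonical_predual)
qed

text \<open>
  The numbers \<open>v i e\<close> determine \<open>e\<close> on \<open>X\<close> through \<open>w e = (\<Sum>i. \<alpha> i w * v i e)\<close>.  The Besselian
  estimate for \<open>\<alpha> i w\<close> and the Cauchy--Schwarz inequality bound this functional of \<open>w\<close>, and its norm
  controls that of \<open>e\<close>.
\<close>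

lemma predual_estimate:
  "\<exists>M\<ge>0. \<forall>e\<in>predual. \<forall>c. summable (\<lambda>i. (c i)\<^sup>2) \<longrightarrow> (\<forall>i\<in>J. blinfun_apply (v i) e = c i) \<longrightarrow>
     norm e \<le> M * sqrt (\<Sum>i. (c i)\<^sup>2)"
proof -
  obtain K where K: "K \<ge> 0"
    "\<forall>\<phi>\<in>dual X norm. \<forall>c\<ge>0. (\<forall>w\<in>X. \<bar>\<phi> w\<bar> \<le> c * norm w) \<longrightarrow> norm (\<iota> \<phi>) \<le> K * c"
    using iota_estimate by (elim exE conjE)
  obtain L where L: "L \<ge> 0" "\<forall>N. \<forall>w\<in>X. L2_set (\<lambda>i. \<alpha> i w) {..<N} \<le> L * norm w"
    using alpha_estimate by (elim exE conjE)
  have "norm e \<le> K * L * sqrt (\<Sum>i. (c i)\<^sup>2)"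
    if e: "e \<in> predual" and c: "summable (\<lambda>i. (c i)\<^sup>2)" and eq: "\<forall>i\<in>J. blinfun_apply (v i) e = c i"
    for e c
  proof -
    have le: "\<bar>blinfun_apply w e\<bar> \<le> (L * sqrt (\<Sum>i. (c i)\<^sup>2)) * norm w" if w: "w \<in> X" for w
    proof (rule tendsto_upperbound)
      have "(\<lambda>N. blinfun_apply (\<Sum>i<N. \<alpha> i w *\<^sub>R v i) e) \<longlonglongrightarrow> blinfun_apply w e"
        using alpha_expansion[OF w] by (intro tendsto_intros)
      moreover have "blinfun_apply (\<Sum>i<N. \<alpha> i w *\<^sub>R v i) e = (\<Sum>i<N. \<alpha> i w * c i)" for N
      proof -
        have "\<alpha> i w * blinfun_apply (v i) e = \<alpha> i w * c i" for i
          using eq alpha_outside[OF _ w, of i] by (cases "i \<in> J") auto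
        then show ?thesis by (simp only: blinfun.sum_left blinfun.scaleR_left real_scaleR_def)
      qed
      ultimately have "(\<lambda>N. \<Sum>i<N. \<alpha> i w * c i) \<longlonglongrightarrow> blinfun_apply w e" by simp
      then show "(\<lambda>N. \<bar>\<Sum>i<N. \<alpha> i w * c i\<bar>) \<longlonglongrightarrow> \<bar>blinfun_apply w e\<bar>"
        by (rule tendsto_rabs)
      show "\<forall>\<^sub>F N in sequentially. \<bar>\<Sum>i<N. \<alpha> i w * c i\<bar> \<le> (L * sqrt (\<Sum>i. (c i)\<^sup>2)) * norm w"
        using sum_product_le_L2[OF c L(2)[rule_format, OF w]] by (simp add: mult_ac)
    qed simp
    have "norm e \<le> norm (canonical e)" by (rule norm_canonical_ge)
    also have "\<dots> = norm (\<iota> (restrict_X (canonical e)))"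
      using canonical_eq_iota_restrict[OF e] by simp
    also have "\<dots> \<le> K * (L * sqrt (\<Sum>i. (c i)\<^sup>2))"
      using le L(1)
      by (intro K(2)[rule_format] restrict_X_in_dual) (auto simp: restrict_X_def suminf_nonneg c)
    finally show ?thesis by (simp add: mult.assoc)
  qed
  then show ?thesis using K(1) L(1) by (intro exI[of _ "K * L"]) auto
qed

text \<open>
  By the Besselian estimate, \<open>w \<mapsto> (\<Sum>i. \<alpha> i w * c i)\<close> is a bounded functional on \<open>X\<close>; the element of
  \<open>E\<^sub>1\<close> that represents it has the prescribed values.
\<close>

lemma predual_interpolation:
  assumes c: "summable (\<lambda>i. (c i)\<^sup>2)"
  shows "\<exists>e\<in>predual. \<forall>i\<in>J. blinfun_apply (v i) e = c i"
proof -
  obtain L where L: "L \<ge> 0" "\<forall>N. \<forall>w\<in>X. L2_set (\<lambda>i. \<alpha> i w) {..<N} \<le> L * norm w"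
    using alpha_estimate by (elim exE conjE)
  define \<phi> where "\<phi> w = (if w \<in> X then \<Sum>i. \<alpha> i w * c i else 0)" for w
  have sums: "summable (\<lambda>i. \<alpha> i w * c i)" if "w \<in> X" for w
    by (intro summable_product_of_squares alpha_square_summable that c)
  have p: "\<phi> \<in> dual X norm"
  proof (rule dualI)
    fix w z assume w: "w \<in> X" "z \<in> X"
    show "\<phi> (w + z) = \<phi> w + \<phi> z"
      using w subspace_add[OF subspace_X w] suminf_add[OF sums[OF w(1)] sums[OF w(2)]]
      by (simp add: \<phi>_def dualD[OF alpha_in_dual] distrib_right)
  next
    fix r w assume w: "w \<in> X"
    show "\<phi> (r *\<^sub>R w) = r * \<phi> w"
      using w subspace_scale[OF subspace_X w] suminf_mult[OF sums[OF w], of r]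
      by (simp add: \<phi>_def dualD[OF alpha_in_dual] mult.assoc)
  next
    fix w assume w: "w \<in> X"
    show "\<bar>\<phi> w\<bar> \<le> (L * sqrt (\<Sum>i. (c i)\<^sup>2)) * norm w"
    proof (rule tendsto_upperbound)
      show "(\<lambda>N. \<bar>\<Sum>i<N. \<alpha> i w * c i\<bar>) \<longlonglongrightarrow> \<bar>\<phi> w\<bar>"
        using summable_LIMSEQ[OF sums[OF w]] w by (intro tendsto_rabs) (simp add: \<phi>_def)
      show "\<forall>\<^sub>F N in sequentially. \<bar>\<Sum>i<N. \<alpha> i w * c i\<bar> \<le> (L * sqrt (\<Sum>i. (c i)\<^sup>2)) * norm w"
        using sum_product_le_L2[OF c L(2)[rule_format, OF w]] by (simp add: mult_ac)
    qed simp
  qed (simp add: \<phi>_def)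
  obtain e where e: "e \<in> predual" "\<iota> \<phi> = canonical e"
    using iota_in_canonical_predual[OF p] by blast
  have "blinfun_apply (v i) e = c i" if i: "i \<in> J" for i
  proof -
    have vi: "v i \<in> X" using basis i by (simp add: schauder_basis_def)
    have "blinfun_apply (v i) e = \<phi> (v i)" using iota_apply[OF p vi] e(2) by simp
    also have "\<dots> = (\<Sum>k. if k = i then c k else 0)"
      using vi biorthogonal_basis_vector[OF basis i]
      by (simp add: \<phi>_def if_distrib[of "\<lambda>r. r * _"] cong: if_cong)
    also have "\<dots> = c i" using sums_unique[OF sums_single[of i c]] by simp
    finally show ?thesis .
  qed
  then show ?thesis using e(1) by blast
qed

end


section \<open>Perturbation\<close>

lemma bounded_linear_betweenD:
  assumes "bounded_linear_between A nA B nB T"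
  shows "x \<in> A \<Longrightarrow> T x \<in> B"
    and "x \<in> A \<Longrightarrow> y \<in> A \<Longrightarrow> T (x + y) = T x + T y"
    and "x \<in> A \<Longrightarrow> T (r *\<^sub>R x) = r *\<^sub>R T x"
    and "\<exists>K. \<forall>x\<in>A. nB (T x) \<le> K * nA x"
  using assms by (auto simp: bounded_linear_between_def)

lemma topological_isomorphism_bounded_below:
  fixes T :: "'a::real_normed_vector \<Rightarrow> 'b::real_vector"
  assumes S: "subspace S" and T: "bounded_linear_between S norm Y nY T"
    and below: "\<And>x. x \<in> S \<Longrightarrow> norm x \<le> K * nY (T x)"
    and zero: "nY 0 = 0"
  shows "topological_isomorphism S norm (T ` S) nY T"
proof -
  note T' = bounded_linear_betweenD[OF T]
  have diff: "T (x - y) = T x - T y" if "x \<in> S" "y \<in> S" for x y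
    using T'(2)[OF that(1) subspace_neg[OF S that(2)]] T'(3)[OF that(2), of "- 1"] by simp
  have inj: "inj_on T S"
  proof (rule inj_onI)
    fix x y assume xy: "x \<in> S" "y \<in> S" "T x = T y"
    then have "norm (x - y) \<le> K * nY 0"
      using below[OF subspace_diff[OF S xy(1,2)]] diff by simp
    then show "x = y" using zero by simp
  qed
  have "bounded_linear_between (T ` S) nY S norm (inv_into S T)"
    unfolding bounded_linear_between_def
  proof (intro conjI ballI allI)
    show "inv_into S T ` T ` S \<subseteq> S" using inj by simp
    show "\<exists>K. \<forall>y\<in>T ` S. norm (inv_into S T y) \<le> K * nY y"
      using below inj by (intro exI[of _ K]) auto
  next
    fix y z assume "y \<in> T ` S" "z \<in> T ` S"
    then obtain u w where u: "u \<in> S" "w \<in> S" "y = T u" "z = T w" by blast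
    have "inv_into S T (T (u + w)) = u + w"
      using inj u subspace_add[OF S] by (intro inv_into_f_f) auto
    then show "inv_into S T (y + z) = inv_into S T y + inv_into S T z"
      using inj u by (simp add: T'(2))
  next
    fix r y assume "y \<in> T ` S"
    then obtain u where u: "u \<in> S" "y = T u" by blast
    have "inv_into S T (T (r *\<^sub>R u)) = r *\<^sub>R u"
      using inj u subspace_scale[OF S] by (intro inv_into_f_f) auto
    then show "inv_into S T (r *\<^sub>R y) = r *\<^sub>R inv_into S T y"
      using inj u by (simp add: T'(3))
  qed
  moreover have "bounded_linear_between S norm (T ` S) nY T"
    using T by (auto simp: bounded_linear_between_def)
  ultimately show ?thesis using inj by (simp add: topological_isomorphism_def bij_betw_def)
qed

context realized_dual begin

text \<open>
  The map \<open>A\<close> is a small perturbation of \<open>B\<close>, and the coordinates of \<open>B\<close> in \<open>J\<close> are the basis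
  functionals.  For \<open>h \<in> E\<close> let \<open>Q h \<in> E\<^sub>1\<close> interpolate the coordinates \<open>A h i\<close>, \<open>i \<in> J\<close>.  With \<open>B\<close> in
  place of \<open>A\<close> this would reproduce every \<open>h \<in> E\<^sub>1\<close>, so for \<open>h \<in> E\<^sub>1\<close> the vectors \<open>Q h\<close> and \<open>h\<close> differ
  by at most half of the norm of \<open>h\<close>.  This bounds \<open>A\<close> from below on \<open>E\<^sub>1\<close>, and it makes
  \<open>a \<mapsto> a + Q (e - a)\<close> a contraction of \<open>E\<^sub>1\<close>, whose fixed point \<open>a\<close> satisfies \<open>A a = A e\<close>: hence
  \<open>A\<close> maps \<open>E\<^sub>1\<close> onto its whole range.
\<close>

theorem perturbed_isomorphism:
  fixes b :: "nat \<Rightarrow> 'f::banach"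
  assumes besselian_b: "besselian UNIV norm UNIV b"
    and est: "\<And>e c. e \<in> predual \<Longrightarrow> c \<in> Y_space b J' \<Longrightarrow>
       (\<And>i. i \<in> J \<Longrightarrow> blinfun_apply (v i) e = c i) \<Longrightarrow> norm e \<le> M * Y_norm b c"
    and A: "bounded_linear_between UNIV norm (Y_space b J') (Y_norm b) A"
    and B: "bounded_linear_between UNIV norm (Y_space b J') (Y_norm b) B"
    and B_v: "\<And>i e. i \<in> J \<Longrightarrow> B e i = blinfun_apply (v i) e"
    and near: "\<And>e. M * Y_norm b (A e - B e) \<le> norm e / 2"
    and determined: "\<And>e. (\<And>i. i \<in> J \<Longrightarrow> A e i = 0) \<Longrightarrow> A e = 0"
  shows "topological_isomorphism predual norm (range A) (Y_norm b) A"
proof -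
  note A' = bounded_linear_betweenD[OF A, simplified]
  note B' = bounded_linear_betweenD[OF B, simplified]
  have A_diff: "A (x - y) = A x - A y" for x y
    using A'(2)[of x "- y"] A'(3)[of "- 1" y] by simp
  have B_diff: "B (x - y) = B x - B y" for x y
    using B'(2)[of x "- y"] B'(3)[of "- 1" y] by simp
  have "\<exists>r\<in>predual. \<forall>i\<in>J. blinfun_apply (v i) r = A h i" for h
    by (intro predual_interpolation besselian_Y_space[OF besselian_b A'(1)])
  then obtain Q where Q: "\<And>h. Q h \<in> predual" "\<And>h i. i \<in> J \<Longrightarrow> blinfun_apply (v i) (Q h) = A h i"
    by metis
  have Q_diff: "norm (h - (Q x - Q y)) \<le> norm h / 2" if h: "h \<in> predual" "h = x - y" for h x y
  proof -
    have "norm (h - (Q x - Q y)) \<le> M * Y_norm b (B h - A h)"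
    proof (rule est)
      show "h - (Q x - Q y) \<in> predual" by (intro subspace_diff subspace_predual h(1) Q)
      show "B h - A h \<in> Y_space b J'" by (intro subspace_diff subspace_Y_space A' B')
      show "blinfun_apply (v i) (h - (Q x - Q y)) = (B h - A h) i" if "i \<in> J" for i
        using Q(2)[OF that] B_v[OF that] by (simp add: blinfun.diff_right h(2) A_diff B_diff)
    qed
    also have "Y_norm b (B h - A h) = Y_norm b (A h - B h)"
      by (rule seminorm_on_commute[OF seminorm_on_Y_norm subspace_Y_space B'(1) A'(1)])
    finally show ?thesis using near[of h] by simp
  qed
  have below: "norm e \<le> (2 * M) * Y_norm b (A e)" if e: "e \<in> predual" for e
  proof -
    have "Q 0 = 0"
    proof -
      have "norm (Q 0) \<le> M * Y_norm b (A 0)" using Q A' by (intro est) auto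
      also have "Y_norm b (A 0) = 0"
        using A'(3)[of 0 0] by (simp add: Y_norm_def)
      finally show ?thesis by simp
    qed
    then have "norm (e - Q e) \<le> norm e / 2" using Q_diff[OF e, of e 0] by simp
    moreover have "norm (Q e) \<le> M * Y_norm b (A e)" using Q A' by (intro est) auto
    ultimately show ?thesis using norm_triangle_ineq[of "e - Q e" "Q e"] by simp
  qed
  have "A e \<in> A ` predual" for e
  proof -
    define G where "G a = a + Q (e - a)" for a
    have "\<exists>!a. a \<in> predual \<and> G a = a"
    proof (rule Banach_fix[where c = "1/2"])
      show "complete predual" using closed_predual by (simp add: complete_eq_closed)
      show "predual \<noteq> {}" using subspace_0[OF subspace_predual] by blast
      show "G ` predual \<subseteq> predual"
        using Q(1) subspace_add[OF subspace_predual] by (auto simp: G_def)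
      show "dist (G x) (G y) \<le> 1/2 * dist x y" if "x \<in> predual" "y \<in> predual" for x y
        using Q_diff[OF subspace_diff[OF subspace_predual that], of "e - y" "e - x"]
        by (simp add: G_def dist_norm algebra_simps)
    qed simp_all
    then obtain a where a: "a \<in> predual" "Q (e - a) = 0" by (auto simp: G_def)
    have "A (e - a) i = 0" if "i \<in> J" for i
      using Q(2)[OF that, of "e - a"] a(2) by simp
    then have "A (e - a) = 0" by (rule determined)
    then show ?thesis using a(1) A_diff[of e a] by auto
  qed
  then have image: "A ` predual = range A" by auto
  have "topological_isomorphism predual norm (A ` predual) (Y_norm b) A"
  proof (rule topological_isomorphism_bounded_below[OF subspace_predual])
    show "bounded_linear_between predual norm (Y_space b J') (Y_norm b) A"
      using A by (auto simp: bounded_linear_between_def)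
    show "norm e \<le> (2 * M) * Y_norm b (A e)" if "e \<in> predual" for e using that by (rule below)
  qed (simp add: Y_norm_def)
  then show ?thesis by (simp only: image)
qed

end


section \<open>The derivative\<close>

text \<open>
  The functionals \<open>D f x i\<close> are defined coordinate by coordinate.  Coordinates are continuous on
  \<open>Y(J)\<close>, so the derivative of \<open>f\<close> as a map into \<open>Y(J)\<close> has them as its coordinates.
\<close>

lemma D_map_eq_derivative:
  fixes f :: "'e::real_normed_vector \<Rightarrow> nat \<Rightarrow> real"
  assumes nz: "\<And>i. b i \<noteq> 0" and U: "open U" "x \<in> U" and fU: "f ` U \<subseteq> Y_space b J"
    and A: "bounded_linear_between UNIV norm (Y_space b J) (Y_norm b) A"
    and lim: "((\<lambda>h. Y_norm b (f (x + h) - f x - A h) / norm h) \<longlongrightarrow> 0) (at 0)"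
  shows "D_map f x J = A"
proof (intro ext)
  fix e i
  note A' = bounded_linear_betweenD[OF A, simplified]
  have coeff: "\<bar>c i\<bar> \<le> 2 / norm (b i) * Y_norm b c" if "c \<in> Y_space b J" for c
    using Y_norm_coeff[OF that, of i] nz[of i] by (simp add: field_simps)
  obtain K where K: "\<And>h. Y_norm b (A h) \<le> K * norm h" using A'(4) by blast
  have bl: "bounded_linear (\<lambda>h. A h i)"
  proof (rule bounded_linear_intro[where K = "2 / norm (b i) * K"])
    show "norm (A h i) \<le> norm h * (2 / norm (b i) * K)" for h
    proof -
      have "norm (A h i) \<le> 2 / norm (b i) * Y_norm b (A h)" using coeff[OF A'(1)] by simp
      also have "\<dots> \<le> 2 / norm (b i) * (K * norm h)" by (intro mult_left_mono K) simp
      finally show ?thesis by (simp add: mult_ac)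
    qed
  qed (simp_all add: A' scaleR_fun_def)
  have "(\<lambda>h. norm (f (x + h) i - f x i - A h i) / norm h) \<midarrow>0\<rightarrow> 0"
  proof (rule Lim_null_comparison)
    show "(\<lambda>h. 2 / norm (b i) * (Y_norm b (f (x + h) - f x - A h) / norm h)) \<midarrow>0\<rightarrow> 0"
      using lim by (rule tendsto_mult_right_zero)
    obtain r where r: "r > 0" "ball x r \<subseteq> U" using U open_contains_ball by blast
    have "norm (norm (f (x + h) i - f x i - A h i) / norm h)
        \<le> 2 / norm (b i) * (Y_norm b (f (x + h) - f x - A h) / norm h)"
      if "h \<noteq> 0" "dist h 0 < r" for h
    proof -
      have "x + h \<in> U" using that r by (auto simp: dist_norm)
      then have "f (x + h) - f x - A h \<in> Y_space b J"
        using fU U(2) by (intro subspace_diff subspace_Y_space A'(1)) auto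
      from divide_right_mono[OF coeff[OF this], of "norm h"] show ?thesis by simp
    qed
    then show "\<forall>\<^sub>F h in at 0. norm (norm (f (x + h) i - f x i - A h i) / norm h)
        \<le> 2 / norm (b i) * (Y_norm b (f (x + h) - f x - A h) / norm h)"
      unfolding eventually_at by (intro exI[of _ r] conjI r(1) ballI impI) simp
  qed
  then have "((\<lambda>y. f y i) has_derivative (\<lambda>h. A h i)) (at x)"
    using bl by (simp add: has_derivative_at)
  then have "frechet_derivative (\<lambda>y. f y i) (at x) = (\<lambda>h. A h i)"
    by (rule frechet_derivative_at[symmetric])
  then have "blinfun_apply (D f x i) e = A e i"
    by (simp add: D_def bounded_linear_Blinfun_apply[OF bl])
  then show "D_map f x J e i = A e i"
    using Y_space_coeff[OF A'(1)] by (simp add: D_map_def)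
qed

text \<open>
  Every \<open>D f x i\<close> with \<open>i \<in> J1\<close> is a norm limit of combinations of those with indices in \<open>J2\<close>.
\<close>

lemma D_map_determined:
  assumes basis: "schauder_basis (D_span f x J1) norm J2 (D f x)"
    and zero: "\<And>i. i \<in> J2 \<Longrightarrow> blinfun_apply (D f x i) e = 0"
  shows "D_map f x J1 e = 0"
proof
  fix i
  show "D_map f x J1 e i = 0 i"
  proof (cases "i \<in> J1")
    case True
    then have "D f x i \<in> D_span f x J1"
      unfolding D_span_def by (intro subsetD[OF closure_subset] span_base) simp
    then obtain a where a: "a \<in> coeffs_on J2" "expansion norm (D f x) a (D f x i)"
      using biorthogonal_expansion[OF basis] by meson
    have "(\<lambda>N. blinfun_apply (\<Sum>k<N. a k *\<^sub>R D f x k) e) \<longlonglongrightarrow> blinfun_apply (D f x i) e"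
      by (intro tendsto_intros basis_expansion_tendsto a)
    moreover have "a k *\<^sub>R blinfun_apply (D f x k) e = 0" for k
      using a(1) zero[of k] by (cases "k \<in> J2") (auto simp: coeffs_on_def)
    then have "blinfun_apply (\<Sum>k<N. a k *\<^sub>R D f x k) e = 0" for N
      by (simp only: blinfun.sum_left blinfun.scaleR_left sum.neutral_const)
    ultimately have "blinfun_apply (D f x i) e = 0" by (simp add: LIMSEQ_const_iff)
    then show ?thesis by (simp add: D_map_def)
  qed (simp add: D_map_def)
qed

theorem proposition4p7:
  fixes b :: "nat \<Rightarrow> 'f::{real_inner, banach}"
    and f :: "'e::banach \<Rightarrow> nat \<Rightarrow> real"
    and U V :: "'e set" and x0 :: 'e and J1 J2 :: "nat set"
    and \<iota> :: "(('e \<Rightarrow>\<^sub>L real) \<Rightarrow> real) \<Rightarrow> (('e \<Rightarrow>\<^sub>L real) \<Rightarrow>\<^sub>L real)"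
  assumes "schauder_basis UNIV norm UNIV b"
    and "besselian UNIV norm UNIV b"
    and "open U" and "x0 \<in> U"
    and "C1_mapping_on U (Y_space b J1) (Y_norm b) f"
    and "bidual_identification (D_span f x0 J1) \<iota>"
    and "V \<subseteq> U"
    and "CRC_plus b f x0 V J1 J2 \<iota>"
  shows "canonical ` E1_space f x0 J1 J2 \<iota> = \<iota> ` dual (D_span f x0 J1) norm \<and>
    (\<exists>W\<subseteq>V. CRC_plus b f x0 W J1 J2 \<iota> \<and>
      (\<forall>x\<in>W. topological_isomorphism (E1_space f x0 J1 J2 \<iota>) norm
                 (range (D_map f x J1)) (Y_norm b) (D_map f x J1)))"
proof -
  note crc = assms(8)[unfolded CRC_plus_def]
  have J21: "J2 \<subseteq> J1" using crc by blast
  interpret realized_dual "D_span f x0 J1" J2 "D f x0" \<iota>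
  proof
    show "subspace (D_span f x0 J1)" "closed (D_span f x0 J1)"
      by (simp_all add: D_span_def subspace_closure)
  qed (use crc assms(6) in \<open>simp_all add: D_dual_def\<close>)
  have E1: "E1_space f x0 J1 J2 \<iota> = predual"
    by (simp add: E1_space_def predual_def D_dual_def)
  have fU: "f ` U \<subseteq> Y_space b J1"
    using assms(5) unfolding C1_mapping_on_def by (rule conjunct1)
  obtain f' where F: "\<forall>x\<in>U. bounded_linear_between UNIV norm (Y_space b J1) (Y_norm b) (f' x) \<and>
      ((\<lambda>h. Y_norm b (f (x + h) - f x - f' x h) / norm h) \<longlongrightarrow> 0) (at 0)"
    and cont: "\<forall>x\<in>U. \<forall>\<epsilon>>0. \<exists>\<delta>>0. \<forall>y\<in>U. dist y x < \<delta> \<longrightarrow>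
      (\<forall>e. Y_norm b (f' y e - f' x e) \<le> \<epsilon> * norm e)"
    using assms(5) unfolding C1_mapping_on_def by (elim conjE exE)
  note f' = F[rule_format, THEN conjunct1] F[rule_format, THEN conjunct2]
  have Df: "f' x = D_map f x J1" if "x \<in> U" for x
    using D_map_eq_derivative[OF schauder_basis_nonzero[OF assms(1)] assms(3) that fU f'(1)[OF that]
        f'(2)[OF that]] by simp
  obtain K where K: "K \<ge> 0" "\<forall>c\<in>Y_space b J1. sqrt (\<Sum>i. (c i)\<^sup>2) \<le> K * Y_norm b c"
    using besselian_estimate[OF assms(1,2), of J1] by (elim exE conjE)
  obtain L where L: "L \<ge> 0" "\<forall>e\<in>predual. \<forall>c. summable (\<lambda>i. (c i)\<^sup>2) \<longrightarrow>
      (\<forall>i\<in>J2. blinfun_apply (D f x0 i) e = c i) \<longrightarrow> norm e \<le> L * sqrt (\<Sum>i. (c i)\<^sup>2)"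
    using predual_estimate by (elim exE conjE)
  define M where "M = L * K"
  have M: "M \<ge> 0" using K(1) L(1) by (simp add: M_def)
  have est: "norm e \<le> M * Y_norm b c"
    if "e \<in> predual" "c \<in> Y_space b J1" "\<And>i. i \<in> J2 \<Longrightarrow> blinfun_apply (D f x0 i) e = c i" for e c
  proof -
    have "norm e \<le> L * sqrt (\<Sum>i. (c i)\<^sup>2)"
      using that besselian_Y_space[OF assms(2)] by (intro L(2)[rule_format]) auto
    also have "\<dots> \<le> L * (K * Y_norm b c)" by (intro mult_left_mono K(2)[rule_format] that L(1))
    finally show ?thesis by (simp add: M_def mult.assoc)
  qed
  \<comment> \<open>The bound \<open>M * \<epsilon> \<le> 1 / 2\<close> is what the perturbation argument needs; \<open>M + 1\<close> avoids \<open>M = 0\<close>.\<close>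
  have \<epsilon>: "0 < 1 / (2 * (M + 1))" using M by simp
  obtain \<delta> where \<delta>: "\<delta> > 0" "\<forall>y\<in>U. dist y x0 < \<delta> \<longrightarrow>
      (\<forall>e. Y_norm b (f' y e - f' x0 e) \<le> (1 / (2 * (M + 1))) * norm e)"
    using cont[rule_format, OF assms(4) \<epsilon>] by (elim exE conjE)
  define W where "W = V \<inter> ball x0 \<delta>"
  have iso: "topological_isomorphism predual norm (range (D_map f x J1)) (Y_norm b) (D_map f x J1)"
    if x: "x \<in> W" for x
  proof (rule perturbed_isomorphism[OF assms(2) est, where B = "D_map f x0 J1"])
    have xV: "x \<in> V" and xU: "x \<in> U" and dist: "dist x x0 < \<delta>"
      using x assms(7) by (auto simp: W_def dist_commute)
    show "bounded_linear_between UNIV norm (Y_space b J1) (Y_norm b) (D_map f x J1)"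
      "bounded_linear_between UNIV norm (Y_space b J1) (Y_norm b) (D_map f x0 J1)"
      using f'(1) Df xU assms(4) by metis+
    show "D_map f x0 J1 e i = blinfun_apply (D f x0 i) e" if "i \<in> J2" for i e
      using that J21 by (auto simp: D_map_def)
    show "M * Y_norm b (D_map f x J1 e - D_map f x0 J1 e) \<le> norm e / 2" for e
    proof -
      have "M * Y_norm b (D_map f x J1 e - D_map f x0 J1 e) \<le> M * ((1 / (2 * (M + 1))) * norm e)"
        using \<delta>(2)[rule_format, OF xU dist, of e] M by (intro mult_left_mono) (simp_all add: Df xU assms(4))
      also have "\<dots> = (M / (M + 1)) * (norm e / 2)" by simp
      also have "\<dots> \<le> norm e / 2" using M by (intro mult_left_le_one_le) auto
      finally show ?thesis .
    qed
    show "D_map f x J1 e = 0" if "\<And>i. i \<in> J2 \<Longrightarrow> D_map f x J1 e i = 0" for e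
    proof (rule D_map_determined)
      show "schauder_basis (D_span f x J1) norm J2 (D f x)" using crc xV by blast
      show "blinfun_apply (D f x i) e = 0" if "i \<in> J2" for i
        using \<open>\<And>i. i \<in> J2 \<Longrightarrow> D_map f x J1 e i = 0\<close>[OF that] that J21 by (auto simp: D_map_def)
    qed
  qed
  have "x0 \<in> interior W" using crc \<delta>(1) by (simp add: W_def interior_open)
  then have "CRC_plus b f x0 W J1 J2 \<iota>"
    unfolding CRC_plus_def using crc by (auto simp: W_def)
  then show ?thesis
    unfolding E1 using canonical_predual iso by (intro conjI exI[of _ W]) (auto simp: W_def)
qed

end
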